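(* Let $(R,\mathfrak m)$ be a commutative noetherian local ring, $I$ an ideal of $R$, $\mathcal P$ the class of all $I$-generated $R$-modules and $\mathcal S$ the class of all $I^\circ$-cogenerated $R$-modules. The following are equivalent: (i) $\mathcal P$ is closed under submodules. (ii) $\mathcal S$ is closed under factor modules. (iii) $\mathcal P=\mathcal S=\{M\in R\text{-}\mathrm{Mod}\mid \operatorname{Ann}_R(I)\cdot M=0\}$. (iv) There is an epimorphism of $R$-modules $I\twoheadrightarrow R/\operatorname{Ann}_R(I)$.
   Context: $E$ is the injective hull of the residue field $R/\mathfrak m$, and $I^\circ=\operatorname{Hom}_R(I,E)$. An $R$-module $M$ is $I$-generated if there is an epimorphism $I^{(\Lambda)}\twoheadrightarrow M$ for some index set $\Lambda$ (direct sum of copies of $I$). An $R$-module $N$ is $I^\circ$-cogenerated if there is a monomorphism $N\hookrightarrow (I^\circ)^\Lambda$ for some index set $\Lambda$ (direct product of copies of $I^\circ$). *)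

theory Defs
  imports "HOL-Algebra.Module" "HOL-Algebra.Ring_Divisibility" "HOL-Library.Equipollence"
begin

text \<open>
  Modules are the records \<open>('a, 'm) module\<close> of HOL-Algebra together with the locale predicate
  \<open>module R M\<close>; the ring fields \<open>mult\<close> and \<open>one\<close> of such a record play no role.
  The type \<open>'m\<close> is the universe of module elements, so a class of modules is a set of type
  \<open>('a, 'm) module set\<close>. Constructions such as quotients, products and Hom-modules
  change the universe, hence homomorphisms are allowed between modules over different types.
  Statements about all modules are meaningful for a universe \<open>'m\<close> that is infinite and contains
  a copy of \<open>R\<close>: it then contains, up to isomorphism, all modules of cardinality at most that of
  \<open>'m\<close>, in particular all finitely generated ones. As \<open>'m\<close> is arbitrary, every module occurs in some
  universe.
\<close>

section \<open>Rings\<close>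

definition local_ring :: "('a, 'b) ring_scheme \<Rightarrow> 'a set \<Rightarrow> bool" where
  "local_ring R \<mm> \<longleftrightarrow> cring R \<and> maximalideal \<mm> R \<and> (\<forall>\<nn>. maximalideal \<nn> R \<longrightarrow> \<nn> = \<mm>)"

section \<open>Homomorphisms and constructions of modules\<close>

definition module_hom ::
  "('a, 'b) ring_scheme \<Rightarrow> ('a, 'm, 'x) module_scheme \<Rightarrow> ('a, 'n, 'y) module_scheme \<Rightarrow> ('m \<Rightarrow> 'n) set"
where
  "module_hom R M N = {f \<in> carrier M \<rightarrow> carrier N.
     (\<forall>x\<in>carrier M. \<forall>y\<in>carrier M. f (x \<oplus>\<^bsub>M\<^esub> y) = f x \<oplus>\<^bsub>N\<^esub> f y) \<and>
     (\<forall>a\<in>carrier R. \<forall>x\<in>carrier M. f (a \<odot>\<^bsub>M\<^esub> x) = a \<odot>\<^bsub>N\<^esub> f x)}"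

definition module_mono ::
  "('a, 'b) ring_scheme \<Rightarrow> ('a, 'm, 'x) module_scheme \<Rightarrow> ('a, 'n, 'y) module_scheme \<Rightarrow> ('m \<Rightarrow> 'n) set"
where
  "module_mono R M N = {f \<in> module_hom R M N. inj_on f (carrier M)}"

definition module_epi ::
  "('a, 'b) ring_scheme \<Rightarrow> ('a, 'm, 'x) module_scheme \<Rightarrow> ('a, 'n, 'y) module_scheme \<Rightarrow> ('m \<Rightarrow> 'n) set"
where
  "module_epi R M N = {f \<in> module_hom R M N. f ` carrier M = carrier N}"

definition module_iso ::
  "('a, 'b) ring_scheme \<Rightarrow> ('a, 'm, 'x) module_scheme \<Rightarrow> ('a, 'n, 'y) module_scheme \<Rightarrow> ('m \<Rightarrow> 'n) set"
where
  "module_iso R M N = {f \<in> module_hom R M N. bij_betw f (carrier M) (carrier N)}"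

definition ideal_module :: "('a, 'b) ring_scheme \<Rightarrow> 'a set \<Rightarrow> ('a, 'a) module" where
  "ideal_module R I =
     \<lparr>carrier = I, monoid.mult = monoid.mult R, one = one R,
      ring.zero = ring.zero R, ring.add = ring.add R, smult = monoid.mult R\<rparr>"

abbreviation ring_module :: "('a, 'b) ring_scheme \<Rightarrow> ('a, 'a) module" where
  "ring_module R \<equiv> ideal_module R (carrier R)"

text \<open>The scalar multiple of a coset \<open>C\<close> is the union over its representatives, as for
  \<open>rcoset_mult\<close> in the library.\<close>

definition quotient_module ::
  "('a, 'm, 'x) module_scheme \<Rightarrow> 'm set \<Rightarrow> ('a, 'm set) module"
where
  "quotient_module M U =
     \<lparr>carrier = a_rcosets\<^bsub>M\<^esub> U, monoid.mult = undefined, one = undefined,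
      ring.zero = U, ring.add = set_add M, smult = (\<lambda>a C. \<Union>x\<in>C. U +>\<^bsub>M\<^esub> (a \<odot>\<^bsub>M\<^esub> x))\<rparr>"

text \<open>The carrier consists of extensional functions (value \<open>undefined\<close> outside
  \<open>carrier M\<close>), so that equality of homomorphisms is equality on \<open>carrier M\<close>.\<close>

definition hom_module ::
  "('a, 'b) ring_scheme \<Rightarrow> ('a, 'm, 'x) module_scheme \<Rightarrow> ('a, 'n, 'y) module_scheme \<Rightarrow> ('a, 'm \<Rightarrow> 'n) module"
where
  "hom_module R M N =
     \<lparr>carrier = module_hom R M N \<inter> extensional (carrier M), monoid.mult = undefined, one = undefined,
      ring.zero = (\<lambda>x\<in>carrier M. \<zero>\<^bsub>N\<^esub>),
      ring.add = (\<lambda>f g. \<lambda>x\<in>carrier M. f x \<oplus>\<^bsub>N\<^esub> g x),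
      smult = (\<lambda>a f. \<lambda>x\<in>carrier M. a \<odot>\<^bsub>N\<^esub> f x)\<rparr>"

definition power_module :: "'l set \<Rightarrow> ('a, 'n, 'y) module_scheme \<Rightarrow> ('a, 'l \<Rightarrow> 'n) module" where
  "power_module \<Lambda> N =
     \<lparr>carrier = \<Lambda> \<rightarrow>\<^sub>E carrier N, monoid.mult = undefined, one = undefined,
      ring.zero = (\<lambda>l\<in>\<Lambda>. \<zero>\<^bsub>N\<^esub>),
      ring.add = (\<lambda>f g. \<lambda>l\<in>\<Lambda>. f l \<oplus>\<^bsub>N\<^esub> g l),
      smult = (\<lambda>a f. \<lambda>l\<in>\<Lambda>. a \<odot>\<^bsub>N\<^esub> f l)\<rparr>"

definition copower_module :: "'l set \<Rightarrow> ('a, 'n, 'y) module_scheme \<Rightarrow> ('a, 'l \<Rightarrow> 'n) module" where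
  "copower_module \<Lambda> N =
     (power_module \<Lambda> N)\<lparr>carrier := {f \<in> \<Lambda> \<rightarrow>\<^sub>E carrier N. finite {l \<in> \<Lambda>. f l \<noteq> \<zero>\<^bsub>N\<^esub>}}\<rparr>"

definition annihilator ::
  "('a, 'b) ring_scheme \<Rightarrow> ('a, 'm, 'x) module_scheme \<Rightarrow> 'a set"
where
  "annihilator R M = {a \<in> carrier R. \<forall>x\<in>carrier M. a \<odot>\<^bsub>M\<^esub> x = \<zero>\<^bsub>M\<^esub>}"

section \<open>Injective hulls\<close>

text \<open>Injectivity is tested on the monomorphisms \<open>A \<rightarrow> B\<close> of modules in the universe \<open>'m\<close>
  of \<open>E\<close>. By Baer's criterion this is injectivity in the unrestricted sense as soon as
  \<open>'m\<close> contains a copy of \<open>R\<close>.\<close>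

definition injective_module :: "('a, 'b) ring_scheme \<Rightarrow> ('a, 'm) module \<Rightarrow> bool" where
  "injective_module R E \<longleftrightarrow> module R E \<and>
     (\<forall>(A :: ('a, 'm) module) (B :: ('a, 'm) module). module R A \<longrightarrow> module R B \<longrightarrow>
        (\<forall>j\<in>module_mono R A B. \<forall>f\<in>module_hom R A E.
           \<exists>g\<in>module_hom R B E. \<forall>x\<in>carrier A. g (j x) = f x))"

definition essential_submodule ::
  "('a, 'b) ring_scheme \<Rightarrow> 'm set \<Rightarrow> ('a, 'm, 'x) module_scheme \<Rightarrow> bool"
where
  "essential_submodule R U M \<longleftrightarrow> submodule U R M \<and>
     (\<forall>V. submodule V R M \<longrightarrow> U \<inter> V = {\<zero>\<^bsub>M\<^esub>} \<longrightarrow> V = {\<zero>\<^bsub>M\<^esub>})"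

definition injective_hull ::
  "('a, 'b) ring_scheme \<Rightarrow> ('a, 'n, 'y) module_scheme \<Rightarrow> ('a, 'm) module \<Rightarrow> bool"
where
  "injective_hull R M E \<longleftrightarrow> injective_module R E \<and>
     (\<exists>j\<in>module_mono R M E. essential_submodule R (j ` carrier M) E)"

section \<open>Generated and cogenerated modules\<close>

text \<open>An index set must live in some type. The types chosen below are large enough: an arbitrary
  index set can be replaced by a set of homomorphisms, see \<open>generated_byI\<close> and
  \<open>cogenerated_byI\<close>.\<close>

definition generated_by ::
  "('a, 'b) ring_scheme \<Rightarrow> ('a, 'g, 'x) module_scheme \<Rightarrow> ('a, 'm, 'y) module_scheme \<Rightarrow> bool"
where
  "generated_by R G M \<longleftrightarrow> (\<exists>\<Lambda> :: ('g \<Rightarrow> 'm) set. module_epi R (copower_module \<Lambda> G) M \<noteq> {})"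

definition cogenerated_by ::
  "('a, 'b) ring_scheme \<Rightarrow> ('a, 'c, 'x) module_scheme \<Rightarrow> ('a, 'm, 'y) module_scheme \<Rightarrow> bool"
where
  "cogenerated_by R C M \<longleftrightarrow> (\<exists>\<Lambda> :: ('m \<Rightarrow> 'c) set. module_mono R M (power_module \<Lambda> C) \<noteq> {})"

definition generated_class ::
  "('a, 'b) ring_scheme \<Rightarrow> ('a, 'g, 'x) module_scheme \<Rightarrow> ('a, 'm) module set"
where
  "generated_class R G = {M. module R M \<and> generated_by R G M}"

definition cogenerated_class ::
  "('a, 'b) ring_scheme \<Rightarrow> ('a, 'c, 'x) module_scheme \<Rightarrow> ('a, 'm) module set"
where
  "cogenerated_class R C = {M. module R M \<and> cogenerated_by R C M}"

definition annihilated_class :: "('a, 'b) ring_scheme \<Rightarrow> 'a set \<Rightarrow> ('a, 'm) module set" where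
  "annihilated_class R J = {M. module R M \<and> (\<forall>a\<in>J. \<forall>x\<in>carrier M. a \<odot>\<^bsub>M\<^esub> x = \<zero>\<^bsub>M\<^esub>)}"

definition closed_under_submodules ::
  "('a, 'b) ring_scheme \<Rightarrow> ('a, 'm) module set \<Rightarrow> bool"
where
  "closed_under_submodules R \<C> \<longleftrightarrow>
     (\<forall>M\<in>\<C>. \<forall>U. submodule U R M \<longrightarrow> M\<lparr>carrier := U\<rparr> \<in> \<C>)"

text \<open>The quotient itself lives over \<open>'m set\<close>; the condition concerns its isomorphic copies in
  the universe \<open>'m\<close>. Such copies exist, for instance on a set of coset representatives.\<close>

definition closed_under_factor_modules ::
  "('a, 'b) ring_scheme \<Rightarrow> ('a, 'm) module set \<Rightarrow> bool"
where
  "closed_under_factor_modules R \<C> \<longleftrightarrow>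
     (\<forall>M\<in>\<C>. \<forall>U. submodule U R M \<longrightarrow>
        (\<forall>Q :: ('a, 'm) module. module R Q \<longrightarrow> module_iso R (quotient_module M U) Q \<noteq> {} \<longrightarrow> Q \<in> \<C>))"

section \<open>The choice of index types is irrelevant\<close>

lemma cogenerated_byI:
  fixes M :: "('a, 'm, 'y) module_scheme" and C :: "('a, 'c, 'x) module_scheme"
    and \<Lambda> :: "'l set"
  assumes f: "f \<in> module_mono R M (power_module \<Lambda> C)" and M: "module R M"
  shows "cogenerated_by R C M"
proof -
  interpret M: module R M by fact
  define H where "H = (\<lambda>l x. f x l) ` \<Lambda>"
  define g where "g = (\<lambda>x. \<lambda>h\<in>H. h x)"
  have fc: "f x \<in> \<Lambda> \<rightarrow>\<^sub>E carrier C" if "x \<in> carrier M" for x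
    using f that by (auto simp: module_mono_def module_hom_def power_module_def)
  have add: "f (x \<oplus>\<^bsub>M\<^esub> y) l = f x l \<oplus>\<^bsub>C\<^esub> f y l"
    if "x \<in> carrier M" "y \<in> carrier M" "l \<in> \<Lambda>" for x y l
    using f that by (auto simp: module_mono_def module_hom_def power_module_def)
  have sm: "f (a \<odot>\<^bsub>M\<^esub> x) l = a \<odot>\<^bsub>C\<^esub> f x l"
    if "a \<in> carrier R" "x \<in> carrier M" "l \<in> \<Lambda>" for a x l
    using f that by (auto simp: module_mono_def module_hom_def power_module_def)
  have "inj_on g (carrier M)"
  proof (rule inj_onI)
    fix x y assume xy: "x \<in> carrier M" "y \<in> carrier M" "g x = g y"
    have "f x l = f y l" if "l \<in> \<Lambda>" for l
    proof -
      have "g x (\<lambda>x. f x l) = g y (\<lambda>x. f x l)" using xy(3) by simp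
      with that show ?thesis by (simp add: g_def H_def)
    qed
    then have "f x = f y"
      using fc[OF xy(1)] fc[OF xy(2)] by (intro PiE_ext[of _ \<Lambda>]) auto
    then show "x = y" using f xy by (auto simp: module_mono_def inj_on_def)
  qed
  moreover have "g \<in> module_hom R M (power_module H C)"
  proof -
    have "g x \<in> H \<rightarrow>\<^sub>E carrier C" if "x \<in> carrier M" for x
      using fc[OF that] by (auto simp: g_def H_def)
    moreover have "g (x \<oplus>\<^bsub>M\<^esub> y) = (\<lambda>h\<in>H. g x h \<oplus>\<^bsub>C\<^esub> g y h)"
      if "x \<in> carrier M" "y \<in> carrier M" for x y
      unfolding g_def by (rule restrict_ext) (use that in \<open>auto simp: H_def add\<close>)
    moreover have "g (a \<odot>\<^bsub>M\<^esub> x) = (\<lambda>h\<in>H. a \<odot>\<^bsub>C\<^esub> g x h)"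
      if "a \<in> carrier R" "x \<in> carrier M" for a x
      unfolding g_def by (rule restrict_ext) (use that in \<open>auto simp: H_def sm\<close>)
    ultimately show ?thesis by (simp add: module_hom_def power_module_def)
  qed
  ultimately show ?thesis
    unfolding cogenerated_by_def module_mono_def by blast
qed

lemma generated_byI:
  fixes M :: "('a, 'm, 'y) module_scheme" and G :: "('a, 'g, 'x) module_scheme"
    and \<Lambda> :: "'l set"
  assumes f: "f \<in> module_epi R (copower_module \<Lambda> G) M" and G: "module R G" and M: "module R M"
  shows "generated_by R G M"
proof -
  interpret G: module R G by fact
  interpret M: module R M by fact
  let ?D = "\<lambda>\<Lambda>. copower_module \<Lambda> G"
  define single where "single = (\<lambda>l x. \<lambda>k\<in>\<Lambda>. if k = l then x else \<zero>\<^bsub>G\<^esub>)"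
  define h where "h = (\<lambda>l. \<lambda>x\<in>carrier G. f (single l x))"
  define H where "H = h ` \<Lambda>"
  define s where "s = inv_into \<Lambda> h"
  have sL: "s k \<in> \<Lambda>" "h (s k) = k" if "k \<in> H" for k
    using that unfolding s_def H_def by (auto intro: inv_into_into f_inv_into_f)
  \<comment> \<open>extend a family on \<open>H\<close> by zero to a family on \<open>\<Lambda>\<close>\<close>
  define ext where "ext = (\<lambda>u. \<lambda>l\<in>\<Lambda>. if h l \<in> H \<and> s (h l) = l then u (h l) else \<zero>\<^bsub>G\<^esub>)"
  define g where "g = (\<lambda>u. f (ext u))"
  have carrH: "u \<in> carrier (?D L) \<longleftrightarrow> u \<in> L \<rightarrow>\<^sub>E carrier G \<and> finite {l \<in> L. u l \<noteq> \<zero>\<^bsub>G\<^esub>}"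
    for u and L :: "('g \<Rightarrow> 'm) set" by (simp add: copower_module_def)
  have carrL: "u \<in> carrier (?D L) \<longleftrightarrow> u \<in> L \<rightarrow>\<^sub>E carrier G \<and> finite {l \<in> L. u l \<noteq> \<zero>\<^bsub>G\<^esub>}"
    for u and L :: "'l set" by (simp add: copower_module_def)
  have addD: "u \<oplus>\<^bsub>?D \<Lambda>\<^esub> v = (\<lambda>l\<in>\<Lambda>. u l \<oplus>\<^bsub>G\<^esub> v l)" for u v
    by (simp add: copower_module_def power_module_def)
  have addH: "u \<oplus>\<^bsub>?D H\<^esub> v = (\<lambda>l\<in>H. u l \<oplus>\<^bsub>G\<^esub> v l)" for u v
    by (simp add: copower_module_def power_module_def)
  have smD: "a \<odot>\<^bsub>?D \<Lambda>\<^esub> v = (\<lambda>l\<in>\<Lambda>. a \<odot>\<^bsub>G\<^esub> v l)" for a v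
    by (simp add: copower_module_def power_module_def)
  have smH: "a \<odot>\<^bsub>?D H\<^esub> v = (\<lambda>l\<in>H. a \<odot>\<^bsub>G\<^esub> v l)" for a v
    by (simp add: copower_module_def power_module_def)
  have fc: "f u \<in> carrier M" if "u \<in> carrier (?D \<Lambda>)" for u
    using f that by (auto simp: module_epi_def module_hom_def)
  have fadd: "f (u \<oplus>\<^bsub>?D \<Lambda>\<^esub> v) = f u \<oplus>\<^bsub>M\<^esub> f v"
    if "u \<in> carrier (?D \<Lambda>)" "v \<in> carrier (?D \<Lambda>)" for u v
    using f that by (auto simp: module_epi_def module_hom_def)
  have fsm: "f (a \<odot>\<^bsub>?D \<Lambda>\<^esub> v) = a \<odot>\<^bsub>M\<^esub> f v"
    if "a \<in> carrier R" "v \<in> carrier (?D \<Lambda>)" for a v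
    using f that by (auto simp: module_epi_def module_hom_def)
  have single_c: "single l x \<in> carrier (?D \<Lambda>)" if "x \<in> carrier G" for l x
  proof -
    have "finite {k \<in> \<Lambda>. single l x k \<noteq> \<zero>\<^bsub>G\<^esub>}"
      by (rule finite_subset[of _ "{l}"]) (auto simp: single_def)
    then show ?thesis using that by (auto simp: carrL single_def)
  qed
  have ext_c: "ext u \<in> carrier (?D \<Lambda>)" if u: "u \<in> carrier (?D H)" for u
  proof -
    have "{l \<in> \<Lambda>. ext u l \<noteq> \<zero>\<^bsub>G\<^esub>} \<subseteq> s ` {k \<in> H. u k \<noteq> \<zero>\<^bsub>G\<^esub>}"
    proof
      fix l assume "l \<in> {l \<in> \<Lambda>. ext u l \<noteq> \<zero>\<^bsub>G\<^esub>}"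
      then have "h l \<in> H" "s (h l) = l" "u (h l) \<noteq> \<zero>\<^bsub>G\<^esub>"
        by (auto simp: ext_def split: if_splits)
      then show "l \<in> s ` {k \<in> H. u k \<noteq> \<zero>\<^bsub>G\<^esub>}" by (intro image_eqI[of _ _ "h l"]) auto
    qed
    then have "finite {l \<in> \<Lambda>. ext u l \<noteq> \<zero>\<^bsub>G\<^esub>}"
      using u by (auto simp: carrH intro: finite_subset)
    moreover have "ext u \<in> \<Lambda> \<rightarrow>\<^sub>E carrier G"
      using u by (auto simp: carrH ext_def)
    ultimately show ?thesis by (simp add: carrL)
  qed
  have ext_add: "ext (u \<oplus>\<^bsub>?D H\<^esub> v) = ext u \<oplus>\<^bsub>?D \<Lambda>\<^esub> ext v" for u v
    by (auto simp: addD addH ext_def fun_eq_iff)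
  have ext_sm: "ext (a \<odot>\<^bsub>?D H\<^esub> v) = a \<odot>\<^bsub>?D \<Lambda>\<^esub> ext v" if "a \<in> carrier R" for a v
    using that by (auto simp: smD smH ext_def fun_eq_iff)
  have H_add_c: "u \<oplus>\<^bsub>?D H\<^esub> v \<in> carrier (?D H)"
    if u: "u \<in> carrier (?D H)" and v: "v \<in> carrier (?D H)" for u v
  proof -
    have "{l \<in> H. (u \<oplus>\<^bsub>?D H\<^esub> v) l \<noteq> \<zero>\<^bsub>G\<^esub>} \<subseteq> {l \<in> H. u l \<noteq> \<zero>\<^bsub>G\<^esub>} \<union> {l \<in> H. v l \<noteq> \<zero>\<^bsub>G\<^esub>}"
      by (auto simp: addH)
    then have "finite {l \<in> H. (u \<oplus>\<^bsub>?D H\<^esub> v) l \<noteq> \<zero>\<^bsub>G\<^esub>}"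
      using u v by (auto simp: carrH intro: finite_subset)
    moreover have "u \<oplus>\<^bsub>?D H\<^esub> v \<in> H \<rightarrow>\<^sub>E carrier G"
      using u v by (auto simp: addH carrH PiE_iff)
    ultimately show ?thesis by (simp add: carrH)
  qed
  have g: "g \<in> module_hom R (?D H) M"
    unfolding module_hom_def g_def by (auto simp: ext_add ext_sm fadd fsm ext_c fc)
  have ext_single: "\<exists>w\<in>carrier (?D H). g w = f (single l x)"
    if l: "l \<in> \<Lambda>" and x: "x \<in> carrier G" for l x
  proof -
    let ?w = "\<lambda>k\<in>H. if k = h l then x else \<zero>\<^bsub>G\<^esub>"
    have "finite {k \<in> H. ?w k \<noteq> \<zero>\<^bsub>G\<^esub>}"
      by (rule finite_subset[of _ "{h l}"]) auto
    then have w: "?w \<in> carrier (?D H)" using x by (auto simp: carrH)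
    have hl: "h l \<in> H" using l by (simp add: H_def)
    have "ext ?w = single (s (h l)) x"
    proof
      fix k
      have "h k \<in> H" if "k \<in> \<Lambda>" using that by (simp add: H_def)
      then show "ext ?w k = single (s (h l)) x k"
        using sL[OF hl] hl by (cases "k = s (h l)") (auto simp del: restrict_apply simp: ext_def single_def restrict_def)
    qed
    moreover have "f (single (s (h l)) x) = h (s (h l)) x" "f (single l x) = h l x"
      using x by (simp_all add: h_def)
    ultimately have "g ?w = f (single l x)" using sL(2)[OF hl] by (simp add: g_def)
    with w show ?thesis by blast
  qed
  have main: "f u \<in> g ` carrier (?D H)"
    if "u \<in> carrier (?D \<Lambda>)" "card {l \<in> \<Lambda>. u l \<noteq> \<zero>\<^bsub>G\<^esub>} = n" for u n
    using that
  proof (induction n arbitrary: u)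
    case 0
    then have u0: "u l = \<zero>\<^bsub>G\<^esub>" if "l \<in> \<Lambda>" for l using that by (auto simp: carrL)
    let ?z = "\<lambda>k\<in>H. \<zero>\<^bsub>G\<^esub>"
    have "?z \<in> carrier (?D H)" by (auto simp: carrH)
    moreover have "ext ?z = u"
    proof (rule PiE_ext[of _ \<Lambda>])
      show "u \<in> \<Lambda> \<rightarrow>\<^sub>E carrier G" using 0 by (simp add: carrL)
      show "ext ?z \<in> \<Lambda> \<rightarrow>\<^sub>E carrier G" by (auto simp: ext_def)
    qed (auto simp: ext_def u0)
    ultimately show ?case unfolding g_def by blast
  next
    case (Suc n)
    then have "{l \<in> \<Lambda>. u l \<noteq> \<zero>\<^bsub>G\<^esub>} \<noteq> {}" by (metis card.empty nat.distinct(1))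
    then obtain l where l: "l \<in> \<Lambda>" "u l \<noteq> \<zero>\<^bsub>G\<^esub>" by blast
    have uP: "u \<in> \<Lambda> \<rightarrow>\<^sub>E carrier G" and ufin: "finite {k \<in> \<Lambda>. u k \<noteq> \<zero>\<^bsub>G\<^esub>}"
      using Suc.prems by (auto simp: carrL)
    let ?v = "u(l := \<zero>\<^bsub>G\<^esub>)"
    have ul: "u l \<in> carrier G" using uP l by auto
    have eq: "{k \<in> \<Lambda>. ?v k \<noteq> \<zero>\<^bsub>G\<^esub>} = {k \<in> \<Lambda>. u k \<noteq> \<zero>\<^bsub>G\<^esub>} - {l}" by auto
    have v: "?v \<in> carrier (?D \<Lambda>)"
      using uP ufin eq l by (auto simp: carrL PiE_iff extensional_def)
    have cv: "card {k \<in> \<Lambda>. ?v k \<noteq> \<zero>\<^bsub>G\<^esub>} = n"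
      unfolding eq using Suc.prems l ufin by simp
    obtain w where w: "w \<in> carrier (?D H)" "g w = f ?v"
      using Suc.IH[OF v cv] by (metis imageE)
    obtain w' where w': "w' \<in> carrier (?D H)" "g w' = f (single l (u l))"
      using ext_single[OF l(1) ul] by blast
    have "?v \<oplus>\<^bsub>?D \<Lambda>\<^esub> single l (u l) = u"
      unfolding addD
    proof (rule PiE_ext[of _ \<Lambda>])
      show "u \<in> \<Lambda> \<rightarrow>\<^sub>E carrier G" by fact
      show "(\<lambda>k\<in>\<Lambda>. ?v k \<oplus>\<^bsub>G\<^esub> single l (u l) k) \<in> \<Lambda> \<rightarrow>\<^sub>E carrier G"
        using PiE_mem[OF uP] ul by (auto simp: single_def intro!: G.M.add.m_closed)
    qed (use PiE_mem[OF uP] ul in \<open>auto simp: single_def\<close>)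
    then have "f u = g w \<oplus>\<^bsub>M\<^esub> g w'"
      using fadd[OF v single_c[OF ul]] w w' by metis
    also have "\<dots> = g (w \<oplus>\<^bsub>?D H\<^esub> w')"
      using g w w' by (auto simp: module_hom_def)
    finally show ?case using H_add_c[OF w(1) w'(1)] by blast
  qed
  have "g ` carrier (?D H) = carrier M"
  proof
    show "g ` carrier (?D H) \<subseteq> carrier M" using g by (auto simp: module_hom_def)
    show "carrier M \<subseteq> g ` carrier (?D H)"
    proof
      fix y assume "y \<in> carrier M"
      then obtain u where "u \<in> carrier (?D \<Lambda>)" "y = f u" using f by (auto simp: module_epi_def)
      then show "y \<in> g ` carrier (?D H)" using main by blast
    qed
  qed
  with g show ?thesis unfolding generated_by_def module_epi_def by blast
qed

end

theory Submission
  imports Defs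
begin

text \<open>
  Write \<open>a = Ann(I)\<close>, and let \<open>s \<in> E\<close> be the image of \<open>1\<close> under \<open>R/m \<rightarrow> E\<close>, so that a scalar
  kills \<open>s\<close> exactly if it lies in \<open>m\<close>. Both classes consist of modules killed by \<open>a\<close>
  (\<open>generated_annihilated\<close>, \<open>cogenerated_annihilated\<close>), and the class of all these modules is
  closed under submodules and factor modules. Everything therefore revolves around (iv): it makes
  both classes as large as possible, and each of the two closure conditions implies it.

  If \<open>\<pi> : I \<rightarrow> R/a\<close> is onto and \<open>M\<close> is killed by \<open>a\<close>, then every \<open>x \<in> M\<close> lies in the image of
  \<open>i \<mapsto> \<pi>(i) x\<close>, so \<open>M\<close> is generated by \<open>I\<close>. A homomorphism \<open>M \<rightarrow> Hom(I, E)\<close> is a bilinear map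
  \<open>M \<times> I \<rightarrow> E\<close>, and since \<open>E\<close> is a cogenerator (\<open>E_cogenerates\<close>), the maps
  \<open>(y, i) \<mapsto> f(\<pi>(i) y)\<close> with \<open>f : M \<rightarrow> E\<close> separate the points of \<open>M\<close>.

  Suppose conversely that no homomorphism \<open>I \<rightarrow> R/a\<close> is onto. As \<open>R\<close> is local and \<open>R/a\<close> is cyclic,
  all of them take values in \<open>m/a\<close> (\<open>no_epi_imp_hom_values\<close>). Let \<open>X\<close> be a finite set of
  generators of \<open>I\<close>.

  (i) fails: \<open>R/a\<close> is isomorphic to the submodule of \<open>I\<^sup>X\<close> generated by \<open>(x)\<^sub>x\<close>. If that submodule
  were generated by \<open>I\<close>, it would be the sum of the images of its homomorphisms from \<open>I\<close>, and these
  lie in \<open>m\<close> times it.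

  (ii) fails: \<open>R/a\<close> is cogenerated by \<open>Hom(I, E)\<close>, hence under (ii) so is every factor module of a
  finite power of \<open>R/a\<close>. In particular, for a suitable finitely generated submodule \<open>W\<close> of \<open>E\<close>
  that contains \<open>s\<close> and is killed by \<open>a\<close>, some bilinear \<open>\<beta> : W \<times> I \<rightarrow> E\<close> has \<open>\<beta>(s, -) \<noteq> 0\<close>, and
  then \<open>\<beta>(s, j) \<noteq> 0\<close> for some \<open>j \<in> X\<close>. This is refuted by a duality argument, which is behind the
  isomorphism of \<open>I \<otimes> Ann\<^sub>E(a)\<close> with \<open>Hom(Hom(I, R/a), E)\<close>. Let \<open>T\<close> be a finite set of generators
  of the module of relations \<open>{t \<in> R\<^sup>X. \<Sum>\<^sub>x t\<^sub>x x = 0}\<close>. If \<open>y \<in> R\<^sup>X\<close> satisfies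
  \<open>\<Sum>\<^sub>x t\<^sub>x y\<^sub>x \<in> a\<close> for all \<open>t \<in> T\<close>, then \<open>x \<mapsto> y\<^sub>x + a\<close> extends to a homomorphism
  \<open>I \<rightarrow> R/a\<close>, so \<open>y\<^sub>j \<in> m\<close> and \<open>y\<^sub>j s = 0\<close>. Hence \<open>y\<^sub>j s\<close> depends only on the image of \<open>y\<close> in
  \<open>(R/a)\<^sup>T\<close>, and injectivity of \<open>E\<close> extends this dependence to a homomorphism \<open>(R/a)\<^sup>T \<rightarrow> E\<close>
  (\<open>no_epi_imp_socle_extension\<close>). The images \<open>w\<^sub>t\<close> of the unit vectors satisfy
  \<open>\<Sum>\<^sub>t t\<^sub>x w\<^sub>t = s\<close> for \<open>x = j\<close> and \<open>= 0\<close> for the other \<open>x \<in> X\<close>, so that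
  \<open>\<beta>(s, j) = \<Sum>\<^sub>x \<beta>(\<Sum>\<^sub>t t\<^sub>x w\<^sub>t, x) = \<Sum>\<^sub>t \<beta>(w\<^sub>t, \<Sum>\<^sub>x t\<^sub>x x) = 0\<close>.

  All modules that enter the closure conditions or the injectivity of \<open>E\<close> have to live in the
  universe of \<open>E\<close>. The ones used here are finite powers of modules no larger than \<open>R\<close>, and
  \<open>finite_PiE_lepoll\<close> and \<open>module_copy_exists\<close> provide copies of them.
\<close>

section \<open>Homomorphisms\<close>

lemma module_homI:
  assumes "\<And>x. x \<in> carrier M \<Longrightarrow> f x \<in> carrier N"
    and "\<And>x y. x \<in> carrier M \<Longrightarrow> y \<in> carrier M \<Longrightarrow> f (x \<oplus>\<^bsub>M\<^esub> y) = f x \<oplus>\<^bsub>N\<^esub> f y"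
    and "\<And>a x. a \<in> carrier R \<Longrightarrow> x \<in> carrier M \<Longrightarrow> f (a \<odot>\<^bsub>M\<^esub> x) = a \<odot>\<^bsub>N\<^esub> f x"
  shows "f \<in> module_hom R M N"
  using assms by (auto simp: module_hom_def)

lemma module_hom_closed: "f \<in> module_hom R M N \<Longrightarrow> x \<in> carrier M \<Longrightarrow> f x \<in> carrier N"
  by (auto simp: module_hom_def)

lemma module_hom_add:
  "f \<in> module_hom R M N \<Longrightarrow> x \<in> carrier M \<Longrightarrow> y \<in> carrier M \<Longrightarrow> f (x \<oplus>\<^bsub>M\<^esub> y) = f x \<oplus>\<^bsub>N\<^esub> f y"
  by (auto simp: module_hom_def)

lemma module_hom_smult:
  "f \<in> module_hom R M N \<Longrightarrow> a \<in> carrier R \<Longrightarrow> x \<in> carrier M \<Longrightarrow> f (a \<odot>\<^bsub>M\<^esub> x) = a \<odot>\<^bsub>N\<^esub> f x"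
  by (auto simp: module_hom_def)

lemma module_hom_zero:
  assumes "module R M" "module R N" "f \<in> module_hom R M N"
  shows "f \<zero>\<^bsub>M\<^esub> = \<zero>\<^bsub>N\<^esub>"
proof -
  interpret M: module R M by fact
  interpret N: module R N by fact
  have "f (\<zero>\<^bsub>R\<^esub> \<odot>\<^bsub>M\<^esub> \<zero>\<^bsub>M\<^esub>) = \<zero>\<^bsub>R\<^esub> \<odot>\<^bsub>N\<^esub> f \<zero>\<^bsub>M\<^esub>"
    using assms(3) by (intro module_hom_smult) auto
  then show ?thesis using module_hom_closed[OF assms(3)] by simp
qed

lemma module_hom_minus:
  assumes "module R M" "module R N" "f \<in> module_hom R M N" "x \<in> carrier M" "y \<in> carrier M"
  shows "f (x \<ominus>\<^bsub>M\<^esub> y) = f x \<ominus>\<^bsub>N\<^esub> f y"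
proof -
  interpret M: module R M by fact
  interpret N: module R N by fact
  have c: "f z \<in> carrier N" if "z \<in> carrier M" for z using module_hom_closed assms(3) that .
  have "f (x \<ominus>\<^bsub>M\<^esub> y) \<oplus>\<^bsub>N\<^esub> f y = f ((x \<ominus>\<^bsub>M\<^esub> y) \<oplus>\<^bsub>M\<^esub> y)"
    using assms by (simp add: module_hom_add)
  also have "(x \<ominus>\<^bsub>M\<^esub> y) \<oplus>\<^bsub>M\<^esub> y = x"
    using assms by (simp add: M.M.minus_eq M.M.a_assoc M.M.l_neg)
  finally have "f x = f (x \<ominus>\<^bsub>M\<^esub> y) \<oplus>\<^bsub>N\<^esub> f y" ..
  then show ?thesis using assms c
    by (simp add: N.M.minus_eq N.M.a_assoc N.M.r_neg)
qed

lemma (in abelian_group) minus_eq_zero_iff: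
  assumes "x \<in> carrier G" "y \<in> carrier G"
  shows "x \<ominus> y = \<zero> \<longleftrightarrow> x = y"
proof
  assume "x \<ominus> y = \<zero>"
  then have "(x \<ominus> y) \<oplus> y = y" using assms by simp
  then show "x = y" using assms by (simp add: minus_eq a_assoc l_neg)
qed (use assms in \<open>simp add: minus_eq r_neg\<close>)

lemma module_hom_comp:
  assumes "f \<in> module_hom R M N" "g \<in> module_hom R N L"
  shows "(\<lambda>x. g (f x)) \<in> module_hom R M L"
  by (rule module_homI)
    (simp_all add: module_hom_closed[OF assms(1)] module_hom_closed[OF assms(2)]
       module_hom_add[OF assms(1)] module_hom_add[OF assms(2)]
       module_hom_smult[OF assms(1)] module_hom_smult[OF assms(2)])

lemma module_hom_pointwise_add:
  assumes "module R N" "f \<in> module_hom R M N" "g \<in> module_hom R M N"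
  shows "(\<lambda>x. f x \<oplus>\<^bsub>N\<^esub> g x) \<in> module_hom R M N"
proof -
  interpret N: module R N by fact
  show ?thesis
    by (rule module_homI)
      (use assms(2,3) in \<open>simp_all add: module_hom_closed module_hom_add module_hom_smult
         N.smult_r_distr N.M.a_ac\<close>)
qed

lemma module_hom_inj_onI:
  assumes "module R M" "module R N" "f \<in> module_hom R M N"
    and "\<And>x. x \<in> carrier M \<Longrightarrow> f x = \<zero>\<^bsub>N\<^esub> \<Longrightarrow> x = \<zero>\<^bsub>M\<^esub>"
  shows "inj_on f (carrier M)"
proof (rule inj_onI)
  interpret M: module R M by fact
  interpret N: module R N by fact
  fix x y assume xy: "x \<in> carrier M" "y \<in> carrier M" "f x = f y"
  have "f (x \<ominus>\<^bsub>M\<^esub> y) = \<zero>\<^bsub>N\<^esub>"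
    using xy assms(3) by (simp add: module_hom_minus[OF assms(1-3)] module_hom_closed N.M.minus_eq N.M.r_neg)
  then have "x \<ominus>\<^bsub>M\<^esub> y = \<zero>\<^bsub>M\<^esub>" using assms(4) xy by simp
  then show "x = y" using xy by (simp add: M.M.minus_eq_zero_iff)
qed

lemma submodule_finsum:
  assumes "module R M" "submodule V R M" "finite A" "\<And>i. i \<in> A \<Longrightarrow> u i \<in> V"
  shows "finsum M u A \<in> V"
proof -
  interpret M: module R M by fact
  note V = M.submoduleE[OF assms(2)]
  have z: "\<zero>\<^bsub>M\<^esub> \<in> V" using V(2) V(4)[OF M.R.zero_closed] V(1) by fastforce
  show ?thesis using assms(3,4)
  proof (induction A rule: finite_induct)
    case (insert a A)
    then have "u \<in> A \<rightarrow> carrier M" "u a \<in> carrier M" using V(1) by auto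
    then show ?case using insert V(5) by simp
  qed (use z in simp)
qed

text \<open>A set with operations receives all module axioms from any module that maps onto it
  compatibly with the operations. Quotients and copies of a module in another type are
  recognised as modules in this way.\<close>

lemma module_surjective_image:
  assumes "module R M" and f: "f \<in> module_epi R M N" and z: "f \<zero>\<^bsub>M\<^esub> = \<zero>\<^bsub>N\<^esub>"
  shows "module R N"
proof -
  interpret M: module R M by fact
  have h: "f \<in> module_hom R M N" and im: "carrier N = f ` carrier M"
    using f by (auto simp: module_epi_def)
  note hs = module_hom_add[OF h, symmetric] module_hom_smult[OF h, symmetric] z[symmetric]
  show ?thesis
  proof (rule moduleI)
    show "abelian_group N"
    proof (rule abelian_groupI)
      fix x y w assume "x \<in> carrier N" "y \<in> carrier N" "w \<in> carrier N"
      then show "(x \<oplus>\<^bsub>N\<^esub> y) \<oplus>\<^bsub>N\<^esub> w = x \<oplus>\<^bsub>N\<^esub> (y \<oplus>\<^bsub>N\<^esub> w)"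
        by (auto simp: im hs M.M.a_assoc)
    next
      fix x assume "x \<in> carrier N"
      then obtain u where u: "u \<in> carrier M" "x = f u" by (auto simp: im)
      then show "\<exists>y\<in>carrier N. y \<oplus>\<^bsub>N\<^esub> x = \<zero>\<^bsub>N\<^esub>"
        by (intro bexI[of _ "f (\<ominus>\<^bsub>M\<^esub> u)"]) (auto simp: im hs M.M.l_neg)
    qed (auto simp: im hs M.M.a_comm)
  qed (use M.R.is_cring in \<open>auto simp: im hs M.smult_l_distr M.smult_r_distr M.smult_assoc1\<close>)
qed

text \<open>This form of the homomorphism theorem replaces quotients by arbitrary epimorphisms, so that
  it also yields maps out of cyclic submodules and out of the ideal generated by a finite set.\<close>

lemma module_hom_factor_epi:
  assumes "module R M" "module R N" "module R L"
    and p: "p \<in> module_epi R M N" and f: "f \<in> module_hom R M L"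
    and ker: "\<And>x. x \<in> carrier M \<Longrightarrow> p x = \<zero>\<^bsub>N\<^esub> \<Longrightarrow> f x = \<zero>\<^bsub>L\<^esub>"
  shows "\<exists>g\<in>module_hom R N L. \<forall>x\<in>carrier M. g (p x) = f x"
proof -
  interpret M: module R M by fact
  interpret N: module R N by fact
  interpret L: module R L by fact
  have ph: "p \<in> module_hom R M N" and im: "carrier N = p ` carrier M"
    using p by (auto simp: module_epi_def)
  define g where "g = (\<lambda>y. f (inv_into (carrier M) p y))"
  have g: "g (p x) = f x" if x: "x \<in> carrier M" for x
  proof -
    define x' where "x' = inv_into (carrier M) p (p x)"
    have x': "x' \<in> carrier M" "p x' = p x"
      using x by (auto simp: x'_def inv_into_into f_inv_into_f)
    have "p (x' \<ominus>\<^bsub>M\<^esub> x) = \<zero>\<^bsub>N\<^esub>"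
      using x x' ph by (simp add: module_hom_minus[OF assms(1,2) ph] module_hom_closed N.M.minus_eq N.M.r_neg)
    then have "f x' \<ominus>\<^bsub>L\<^esub> f x = \<zero>\<^bsub>L\<^esub>"
      using ker[of "x' \<ominus>\<^bsub>M\<^esub> x"] x x' by (simp add: module_hom_minus[OF assms(1,3) f])
    then show ?thesis using module_hom_closed[OF f] x x'(1) by (simp add: g_def x'_def L.M.minus_eq_zero_iff)
  qed
  have "g \<in> module_hom R N L"
    by (rule module_homI)
      (auto simp: im g module_hom_closed[OF f] module_hom_add[OF f] module_hom_smult[OF f]
         module_hom_add[OF ph, symmetric] module_hom_smult[OF ph, symmetric])
  with g show ?thesis by blast
qed

lemma submodule_module: "module R M \<Longrightarrow> submodule U R M \<Longrightarrow> module R (M\<lparr>carrier := U\<rparr>)"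
  by (rule submodule.submodule_is_module)

lemma submodule_zero:
  assumes "module R M" "submodule U R M" shows "\<zero>\<^bsub>M\<^esub> \<in> U"
proof -
  interpret module R M by fact
  show ?thesis
    using submodule_finsum[OF assms finite.emptyI, of "\<lambda>_. \<zero>\<^bsub>M\<^esub>"] by simp
qed

lemma module_hom_preimage_submodule:
  assumes "module R M" "module R N" "f \<in> module_hom R M N" "submodule V R N"
  shows "submodule {x \<in> carrier M. f x \<in> V} R M"
proof -
  interpret M: module R M by fact
  interpret N: module R N by fact
  note V = N.submoduleE[OF assms(4)]
  have m: "f (\<ominus>\<^bsub>M\<^esub> x) = \<ominus>\<^bsub>N\<^esub> f x" if "x \<in> carrier M" for x
    using module_hom_minus[OF assms(1-3) M.M.zero_closed that] module_hom_zero[OF assms(1-3)] that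
      module_hom_closed[OF assms(3) that]
    by (simp add: M.M.minus_eq N.M.minus_eq)
  show ?thesis
    by (rule M.submoduleI) (use assms(3) V submodule_zero[OF assms(2,4)] in \<open>auto simp: module_hom_zero[OF assms(1-3)] m
      module_hom_add module_hom_smult\<close>)
qed

lemma module_hom_image_submodule:
  assumes "module R M" "module R N" "f \<in> module_hom R M N" "submodule V R M"
  shows "submodule (f ` V) R N"
proof -
  interpret M: module R M by fact
  interpret N: module R N by fact
  note V = M.submoduleE[OF assms(4)]
  have m: "\<ominus>\<^bsub>N\<^esub> f x = f (\<ominus>\<^bsub>M\<^esub> x)" if "x \<in> carrier M" for x
    using module_hom_minus[OF assms(1-3) M.M.zero_closed that] module_hom_zero[OF assms(1-3)] that
      module_hom_closed[OF assms(3) that]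
    by (simp add: M.M.minus_eq N.M.minus_eq)
  have z: "\<zero>\<^bsub>N\<^esub> \<in> f ` V"
    using submodule_zero[OF assms(1,4)] module_hom_zero[OF assms(1-3)] by (metis imageI)
  have c: "x \<in> V \<Longrightarrow> x \<in> carrier M" for x using V(1) by auto
  show ?thesis
    by (rule N.submoduleI)
      (use V z c in \<open>auto simp: m module_hom_closed[OF assms(3)]
         module_hom_add[OF assms(3), symmetric] module_hom_smult[OF assms(3), symmetric]\<close>)
qed

lemma zero_submodule:
  assumes "module R M" shows "submodule {\<zero>\<^bsub>M\<^esub>} R M"
proof -
  interpret module R M by fact
  show ?thesis by (rule submoduleI) auto
qed

lemma module_iso_inverse:
  assumes "module R M" and f: "f \<in> module_iso R M N"
  shows "\<exists>g\<in>module_iso R N M. (\<forall>x\<in>carrier M. g (f x) = x) \<and> (\<forall>y\<in>carrier N. f (g y) = y)"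
proof -
  interpret module R M by fact
  have h: "f \<in> module_hom R M N" and b: "bij_betw f (carrier M) (carrier N)"
    using f by (auto simp: module_iso_def)
  let ?g = "inv_into (carrier M) f"
  have gf: "?g (f x) = x" if "x \<in> carrier M" for x using b that by (simp add: bij_betw_def)
  have fg: "f (?g y) = y" if "y \<in> carrier N" for y using b that by (simp add: bij_betw_inv_into_right)
  have gb: "bij_betw ?g (carrier N) (carrier M)" using b by (rule bij_betw_inv_into)
  have gc: "?g y \<in> carrier M" if "y \<in> carrier N" for y using gb that by (auto simp: bij_betw_def)
  have "?g \<in> module_hom R N M"
  proof (rule module_homI)
    fix x y assume "x \<in> carrier N" "y \<in> carrier N"
    then show "?g (x \<oplus>\<^bsub>N\<^esub> y) = ?g x \<oplus>\<^bsub>M\<^esub> ?g y"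
      using gf[of "?g x \<oplus>\<^bsub>M\<^esub> ?g y"] gc by (simp add: module_hom_add[OF h] fg)
  next
    fix a x assume "a \<in> carrier R" "x \<in> carrier N"
    then show "?g (a \<odot>\<^bsub>N\<^esub> x) = a \<odot>\<^bsub>M\<^esub> ?g x"
      using gf[of "a \<odot>\<^bsub>M\<^esub> ?g x"] gc by (simp add: module_hom_smult[OF h] fg)
  qed (rule gc)
  then have "?g \<in> module_iso R N M" using gb by (simp add: module_iso_def)
  then show ?thesis using gf fg by blast
qed

lemma module_iso_hom: "f \<in> module_iso R M N \<Longrightarrow> f \<in> module_hom R M N"
  by (simp add: module_iso_def)

lemma module_iso_epi: "f \<in> module_iso R M N \<Longrightarrow> f \<in> module_epi R M N"
  by (auto simp: module_iso_def module_epi_def bij_betw_def)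

section \<open>Powers and copowers\<close>

lemma restrict_eq_iff: "(\<lambda>l\<in>\<Lambda>. f l) = (\<lambda>l\<in>\<Lambda>. g l) \<longleftrightarrow> (\<forall>l\<in>\<Lambda>. f l = g l)"
  by (auto simp: restrict_def fun_eq_iff)

lemma module_power:
  assumes "module R N" shows "module R (power_module \<Lambda> N)"
proof -
  interpret N: module R N by fact
  have c: "u l \<in> carrier N" if "u \<in> \<Lambda> \<rightarrow>\<^sub>E carrier N" "l \<in> \<Lambda>" for u l
    using that by auto
  have e': "(\<lambda>l\<in>\<Lambda>. f l) = u \<longleftrightarrow> (\<forall>l\<in>\<Lambda>. f l = u l)" if "u \<in> \<Lambda> \<rightarrow>\<^sub>E carrier N" for f u
    using that by (auto simp: restrict_def fun_eq_iff PiE_def extensional_def)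
  show ?thesis
  proof (rule moduleI)
    show "abelian_group (power_module \<Lambda> N)"
    proof (rule abelian_groupI)
      fix u assume u: "u \<in> carrier (power_module \<Lambda> N)"
      show "\<exists>v\<in>carrier (power_module \<Lambda> N). v \<oplus>\<^bsub>power_module \<Lambda> N\<^esub> u = \<zero>\<^bsub>power_module \<Lambda> N\<^esub>"
        using u by (intro bexI[of _ "\<lambda>l\<in>\<Lambda>. \<ominus>\<^bsub>N\<^esub> u l"])
          (auto simp: power_module_def restrict_eq_iff N.M.l_neg c)
    qed (auto simp: power_module_def restrict_eq_iff e' c N.M.a_ac)
  qed (use N.R.is_cring in \<open>auto simp: power_module_def restrict_eq_iff e' c N.smult_l_distr N.smult_r_distr
         N.smult_assoc1\<close>)
qed

lemma power_module_simps:
  "carrier (power_module \<Lambda> N) = \<Lambda> \<rightarrow>\<^sub>E carrier N"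
  "\<zero>\<^bsub>power_module \<Lambda> N\<^esub> = (\<lambda>l\<in>\<Lambda>. \<zero>\<^bsub>N\<^esub>)"
  "u \<oplus>\<^bsub>power_module \<Lambda> N\<^esub> v = (\<lambda>l\<in>\<Lambda>. u l \<oplus>\<^bsub>N\<^esub> v l)"
  "a \<odot>\<^bsub>power_module \<Lambda> N\<^esub> v = (\<lambda>l\<in>\<Lambda>. a \<odot>\<^bsub>N\<^esub> v l)"
  by (simp_all add: power_module_def)

lemma copower_module_simps:
  "carrier (copower_module \<Lambda> N) = {u \<in> \<Lambda> \<rightarrow>\<^sub>E carrier N. finite {l \<in> \<Lambda>. u l \<noteq> \<zero>\<^bsub>N\<^esub>}}"
  "u \<oplus>\<^bsub>copower_module \<Lambda> N\<^esub> v = (\<lambda>l\<in>\<Lambda>. u l \<oplus>\<^bsub>N\<^esub> v l)"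
  "a \<odot>\<^bsub>copower_module \<Lambda> N\<^esub> v = (\<lambda>l\<in>\<Lambda>. a \<odot>\<^bsub>N\<^esub> v l)"
  by (simp_all add: copower_module_def power_module_def)

lemma copower_module_finite: "finite \<Lambda> \<Longrightarrow> copower_module \<Lambda> N = power_module \<Lambda> N"
  by (simp add: copower_module_def power_module_def)

lemma hom_into_power:
  assumes "\<And>l. l \<in> \<Lambda> \<Longrightarrow> h l \<in> module_hom R M N"
  shows "(\<lambda>x. \<lambda>l\<in>\<Lambda>. h l x) \<in> module_hom R M (power_module \<Lambda> N)"
  by (rule module_homI)
    (auto simp: power_module_simps module_hom_closed[OF assms] module_hom_add[OF assms]
       module_hom_smult[OF assms] intro!: restrict_ext)

lemma power_proj_hom:
  "l \<in> \<Lambda> \<Longrightarrow> (\<lambda>u. u l) \<in> module_hom R (power_module \<Lambda> N) N"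
  by (rule module_homI) (auto simp: power_module_simps)

definition summand_map :: "'l set \<Rightarrow> ('a, 'n, 'y) module_scheme \<Rightarrow> 'l \<Rightarrow> 'n \<Rightarrow> 'l \<Rightarrow> 'n" where
  "summand_map \<Lambda> N l x = (\<lambda>k\<in>\<Lambda>. if k = l then x else \<zero>\<^bsub>N\<^esub>)"

lemma summand_map_closed:
  assumes "module R N" "x \<in> carrier N"
  shows "summand_map \<Lambda> N l x \<in> carrier (copower_module \<Lambda> N)"
proof -
  interpret module R N by fact
  have "finite {k \<in> \<Lambda>. summand_map \<Lambda> N l x k \<noteq> \<zero>\<^bsub>N\<^esub>}"
    by (rule finite_subset[of _ "{l}"]) (auto simp: summand_map_def)
  then show ?thesis using assms(2) by (auto simp: copower_module_simps summand_map_def)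
qed

lemma summand_map_hom:
  assumes "module R N" shows "summand_map \<Lambda> N l \<in> module_hom R N (copower_module \<Lambda> N)"
proof -
  interpret module R N by fact
  show ?thesis
    by (rule module_homI)
      (auto simp: summand_map_closed[OF assms] copower_module_simps(2,3),
       auto simp: summand_map_def fun_eq_iff)
qed

text \<open>A homomorphism out of a direct sum is determined by its restrictions to the summands. The
  set \<open>S\<close> need only contain the support of \<open>u\<close>; this covers both the support itself, for infinite
  \<open>\<Lambda>\<close>, and the whole of a finite \<open>\<Lambda>\<close>.\<close>

lemma hom_copower_expand:
  assumes "module R N" "module R M" "F \<in> module_hom R (copower_module \<Lambda> N) M"
    and "finite S" "S \<subseteq> \<Lambda>" "u \<in> carrier (copower_module \<Lambda> N)" "\<forall>l\<in>\<Lambda> - S. u l = \<zero>\<^bsub>N\<^esub>"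
  shows "F u = (\<Oplus>\<^bsub>M\<^esub>l\<in>S. F (summand_map \<Lambda> N l (u l)))"
proof -
  interpret N: module R N by fact
  interpret M: module R M by fact
  show ?thesis using assms(4-)
  proof (induction S arbitrary: u rule: finite_induct)
    case empty
    then have "\<zero>\<^bsub>R\<^esub> \<odot>\<^bsub>copower_module \<Lambda> N\<^esub> u = u"
      by (auto simp: copower_module_simps fun_eq_iff PiE_def extensional_def)
    then have "F u = F (\<zero>\<^bsub>R\<^esub> \<odot>\<^bsub>copower_module \<Lambda> N\<^esub> u)" by (rule arg_cong[OF sym])
    also have "\<dots> = \<zero>\<^bsub>R\<^esub> \<odot>\<^bsub>M\<^esub> F u"
      by (rule module_hom_smult[OF assms(3) N.R.zero_closed empty(2)])
    finally show ?case using module_hom_closed[OF assms(3) empty(2)] by simp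
  next
    case (insert a S)
    let ?v = "u(a := \<zero>\<^bsub>N\<^esub>)"
    have uP: "u \<in> \<Lambda> \<rightarrow>\<^sub>E carrier N" using insert.prems by (simp add: copower_module_simps)
    have ul: "u l \<in> carrier N" if "l \<in> \<Lambda>" for l using uP that by auto
    have v: "?v \<in> carrier (copower_module \<Lambda> N)"
    proof -
      have "finite {l \<in> \<Lambda>. ?v l \<noteq> \<zero>\<^bsub>N\<^esub>}"
        by (rule finite_subset[of _ "{l \<in> \<Lambda>. u l \<noteq> \<zero>\<^bsub>N\<^esub>}"])
          (use insert.prems in \<open>auto simp: copower_module_simps\<close>)
      then show ?thesis using uP insert.prems
        by (auto simp: copower_module_simps PiE_iff extensional_def)
    qed
    have aL: "a \<in> \<Lambda>" using insert.prems by auto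
    have s: "summand_map \<Lambda> N l (u l) \<in> carrier (copower_module \<Lambda> N)" if "l \<in> \<Lambda>" for l
      by (rule summand_map_closed[OF assms(1) ul[OF that]])
    have Fs: "F (summand_map \<Lambda> N l (u l)) \<in> carrier M" if "l \<in> \<Lambda>" for l
      by (rule module_hom_closed[OF assms(3) s[OF that]])
    have "summand_map \<Lambda> N a (u a) \<oplus>\<^bsub>copower_module \<Lambda> N\<^esub> ?v = u"
      using uP aL ul by (auto simp: copower_module_simps summand_map_def fun_eq_iff PiE_def extensional_def)
    then have "F u = F (summand_map \<Lambda> N a (u a)) \<oplus>\<^bsub>M\<^esub> F ?v"
      using module_hom_add[OF assms(3) s[OF aL] v] by simp
    also have "F ?v = (\<Oplus>\<^bsub>M\<^esub>l\<in>S. F (summand_map \<Lambda> N l (?v l)))"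
      by (rule insert.IH[OF _ v]) (use insert.prems in auto)
    also have "\<dots> = (\<Oplus>\<^bsub>M\<^esub>l\<in>S. F (summand_map \<Lambda> N l (u l)))"
      using insert.hyps insert.prems by (intro M.M.finsum_cong') (auto intro!: Fs)
    also have "F (summand_map \<Lambda> N a (u a)) \<oplus>\<^bsub>M\<^esub> \<dots> = (\<Oplus>\<^bsub>M\<^esub>l\<in>insert a S. F (summand_map \<Lambda> N l (u l)))"
      using insert.hyps insert.prems by (subst M.M.finsum_insert) (auto intro!: Fs)
    finally show ?case .
  qed
qed

lemma hom_copower_exists:
  assumes "module R N" "module R M" and h: "\<And>l. l \<in> \<Lambda> \<Longrightarrow> h l \<in> module_hom R N M"
  shows "\<exists>F\<in>module_hom R (copower_module \<Lambda> N) M.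
    \<forall>l\<in>\<Lambda>. \<forall>x\<in>carrier N. F (summand_map \<Lambda> N l x) = h l x"
proof -
  interpret N: module R N by fact
  interpret M: module R M by fact
  let ?C = "copower_module \<Lambda> N"
  define supp where "supp = (\<lambda>u. {l \<in> \<Lambda>. u l \<noteq> \<zero>\<^bsub>N\<^esub>})"
  define F where "F = (\<lambda>u. \<Oplus>\<^bsub>M\<^esub>l\<in>supp u. h l (u l))"
  have fin: "finite (supp u)" if "u \<in> carrier ?C" for u
    using that by (simp add: copower_module_simps supp_def)
  have hc: "h l (u l) \<in> carrier M" if "l \<in> \<Lambda>" "u \<in> carrier ?C" for l u
    using that by (auto simp: copower_module_simps intro!: module_hom_closed[OF h])
  have F: "F u = (\<Oplus>\<^bsub>M\<^esub>l\<in>S. h l (u l))"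
    if S: "u \<in> carrier ?C" "finite S" "supp u \<subseteq> S" "S \<subseteq> \<Lambda>" for u S
    unfolding F_def
  proof (rule M.M.add.finprod_mono_neutral_cong_left)
    show "h i (u i) = \<zero>\<^bsub>M\<^esub>" if i: "i \<in> S - supp u" for i
    proof -
      have "i \<in> \<Lambda>" "u i = \<zero>\<^bsub>N\<^esub>" using i S by (auto simp: supp_def)
      then show ?thesis using module_hom_zero[OF assms(1,2) h] by simp
    qed
  qed (use S hc in auto)
  have "F \<in> module_hom R ?C M"
  proof (rule module_homI)
    fix u assume u: "u \<in> carrier ?C"
    show "F u \<in> carrier M"
      unfolding F_def by (rule M.M.finsum_closed) (use hc u in \<open>auto simp: supp_def\<close>)
    fix a assume a: "a \<in> carrier R"
    have eq: "(a \<odot>\<^bsub>?C\<^esub> u) l = a \<odot>\<^bsub>N\<^esub> u l" if "l \<in> \<Lambda>" for l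
      using that by (simp add: copower_module_simps)
    have sub: "supp (a \<odot>\<^bsub>?C\<^esub> u) \<subseteq> supp u" using a by (auto simp: supp_def eq)
    have au: "a \<odot>\<^bsub>?C\<^esub> u \<in> carrier ?C"
      using finite_subset[OF sub fin[OF u]] u a unfolding supp_def
      by (auto simp: copower_module_simps)
    have "F (a \<odot>\<^bsub>?C\<^esub> u) = (\<Oplus>\<^bsub>M\<^esub>l\<in>supp u. h l ((a \<odot>\<^bsub>?C\<^esub> u) l))"
      using sub fin[OF u] au by (intro F) (auto simp: supp_def)
    also have "\<dots> = (\<Oplus>\<^bsub>M\<^esub>l\<in>supp u. a \<odot>\<^bsub>M\<^esub> h l (u l))"
    proof (rule M.M.finsum_cong'[OF refl])
      fix l assume l: "l \<in> supp u"
      then have "u l \<in> carrier N" "l \<in> \<Lambda>" using u by (auto simp: supp_def copower_module_simps)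
      then show "h l ((a \<odot>\<^bsub>?C\<^esub> u) l) = a \<odot>\<^bsub>M\<^esub> h l (u l)"
        using a by (simp add: eq module_hom_smult[OF h])
    qed (use hc u a in \<open>auto simp: supp_def\<close>)
    also have "\<dots> = a \<odot>\<^bsub>M\<^esub> F u"
      unfolding F_def
      by (rule M.finsum_smult_ldistr[symmetric]) (use fin u a hc in \<open>auto simp: supp_def\<close>)
    finally show "F (a \<odot>\<^bsub>?C\<^esub> u) = a \<odot>\<^bsub>M\<^esub> F u" .
  next
    fix u v assume u: "u \<in> carrier ?C" and v: "v \<in> carrier ?C"
    let ?S = "supp u \<union> supp v"
    have fS: "finite ?S" and SL: "?S \<subseteq> \<Lambda>" using fin u v by (auto simp: supp_def)
    have eq: "(u \<oplus>\<^bsub>?C\<^esub> v) l = u l \<oplus>\<^bsub>N\<^esub> v l" if "l \<in> \<Lambda>" for l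
      using that by (simp add: copower_module_simps)
    have uv: "supp (u \<oplus>\<^bsub>?C\<^esub> v) \<subseteq> ?S" by (auto simp: supp_def eq)
    have auv: "u \<oplus>\<^bsub>?C\<^esub> v \<in> carrier ?C"
      using finite_subset[OF uv fS] u v unfolding supp_def by (auto simp: copower_module_simps)
    have "F (u \<oplus>\<^bsub>?C\<^esub> v) = (\<Oplus>\<^bsub>M\<^esub>l\<in>?S. h l ((u \<oplus>\<^bsub>?C\<^esub> v) l))"
      using uv fS SL auv by (intro F) auto
    also have "\<dots> = (\<Oplus>\<^bsub>M\<^esub>l\<in>?S. h l (u l) \<oplus>\<^bsub>M\<^esub> h l (v l))"
    proof (rule M.M.finsum_cong'[OF refl])
      fix l assume "l \<in> ?S"
      then have "u l \<in> carrier N" "v l \<in> carrier N" "l \<in> \<Lambda>"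
        using u v by (auto simp: supp_def copower_module_simps)
      then show "h l ((u \<oplus>\<^bsub>?C\<^esub> v) l) = h l (u l) \<oplus>\<^bsub>M\<^esub> h l (v l)"
        by (simp add: eq module_hom_add[OF h])
    qed (use SL hc u v in auto)
    also have "\<dots> = (\<Oplus>\<^bsub>M\<^esub>l\<in>?S. h l (u l)) \<oplus>\<^bsub>M\<^esub> (\<Oplus>\<^bsub>M\<^esub>l\<in>?S. h l (v l))"
      by (rule M.M.finsum_addf) (use SL hc u v in auto)
    also have "\<dots> = F u \<oplus>\<^bsub>M\<^esub> F v"
      using F[OF u fS _ SL] F[OF v fS _ SL] by simp
    finally show "F (u \<oplus>\<^bsub>?C\<^esub> v) = F u \<oplus>\<^bsub>M\<^esub> F v" .
  qed
  moreover have "F (summand_map \<Lambda> N l x) = h l x" if "l \<in> \<Lambda>" "x \<in> carrier N" for l x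
  proof -
    have "F (summand_map \<Lambda> N l x) = (\<Oplus>\<^bsub>M\<^esub>k\<in>{l}. h k (summand_map \<Lambda> N l x k))"
      using that by (intro F summand_map_closed[OF assms(1)])
        (auto simp: supp_def summand_map_def)
    then show ?thesis using that by (simp add: summand_map_def module_hom_closed[OF h])
  qed
  ultimately show ?thesis by blast
qed

section \<open>Quotients, ideals and copies\<close>

lemma submodule_abelian_subgroup:
  assumes "module R M" "submodule U R M" shows "abelian_subgroup U M"
proof -
  interpret module R M by fact
  interpret submodule U R M by fact
  show ?thesis
    by (rule abelian_subgroupI3) (simp_all add: additive_subgroup_def subgroup_axioms M.abelian_group_axioms)
qed

lemma quotient_module_proj:
  assumes "module R M" "submodule U R M"
  shows "a_r_coset M U \<in> module_epi R M (quotient_module M U)"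
proof -
  interpret M: module R M by fact
  interpret U: abelian_subgroup U M by (rule submodule_abelian_subgroup) fact+
  note sub = M.submoduleE[OF assms(2)]
  have eq: "U +>\<^bsub>M\<^esub> x = U +>\<^bsub>M\<^esub> y"
    if "x \<in> U +>\<^bsub>M\<^esub> y" "y \<in> carrier M" for x y
    using M.a_repr_independence[OF that U.a_subgroup] by simp
  have smult: "(\<Union>y\<in>U +>\<^bsub>M\<^esub> x. U +>\<^bsub>M\<^esub> (a \<odot>\<^bsub>M\<^esub> y)) = U +>\<^bsub>M\<^esub> (a \<odot>\<^bsub>M\<^esub> x)"
    if a: "a \<in> carrier R" and x: "x \<in> carrier M" for a x
  proof -
    have "U +>\<^bsub>M\<^esub> (a \<odot>\<^bsub>M\<^esub> y) = U +>\<^bsub>M\<^esub> (a \<odot>\<^bsub>M\<^esub> x)" if y: "y \<in> U +>\<^bsub>M\<^esub> x" for y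
    proof (rule eq)
      obtain u where u: "u \<in> U" "y = u \<oplus>\<^bsub>M\<^esub> x"
        using y by (auto simp: a_r_coset_def')
      have "a \<odot>\<^bsub>M\<^esub> u \<in> U" using sub(4) a u by simp
      moreover have "a \<odot>\<^bsub>M\<^esub> y = a \<odot>\<^bsub>M\<^esub> u \<oplus>\<^bsub>M\<^esub> a \<odot>\<^bsub>M\<^esub> x"
        using u a x sub(1) by (auto simp: M.smult_r_distr)
      ultimately show "a \<odot>\<^bsub>M\<^esub> y \<in> U +>\<^bsub>M\<^esub> (a \<odot>\<^bsub>M\<^esub> x)"
        by (auto simp: a_r_coset_def')
    qed (use a x in simp)
    then have "(\<Union>y\<in>U +>\<^bsub>M\<^esub> x. U +>\<^bsub>M\<^esub> (a \<odot>\<^bsub>M\<^esub> y)) = (\<Union>y\<in>U +>\<^bsub>M\<^esub> x. U +>\<^bsub>M\<^esub> (a \<odot>\<^bsub>M\<^esub> x))"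
      by (rule SUP_cong[OF refl])
    then show ?thesis using U.a_rcos_self[OF x] by (simp only: UN_constant) auto
  qed
  have "a_r_coset M U \<in> module_hom R M (quotient_module M U)"
    by (rule module_homI)
      (auto simp: quotient_module_def smult U.a_rcos_sum intro: M.a_rcosetsI[OF sub(1)])
  moreover have "carrier (quotient_module M U) = a_r_coset M U ` carrier M"
    by (auto simp: quotient_module_def A_RCOSETS_def')
  ultimately show ?thesis by (simp add: module_epi_def)
qed

lemma quotient_module_proj_eq_zero:
  assumes "module R M" "submodule U R M" "x \<in> carrier M"
  shows "U +>\<^bsub>M\<^esub> x = \<zero>\<^bsub>quotient_module M U\<^esub> \<longleftrightarrow> x \<in> U"
proof -
  interpret M: module R M by fact
  interpret U: abelian_subgroup U M by (rule submodule_abelian_subgroup) fact+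
  show ?thesis
    using M.a_coset_join1[OF _ assms(3) U.a_subgroup] M.a_coset_join2[OF assms(3) U.a_subgroup]
    by (auto simp: quotient_module_def)
qed

lemma module_quotient:
  assumes "module R M" "submodule U R M" shows "module R (quotient_module M U)"
proof (rule module_surjective_image[OF assms(1) quotient_module_proj[OF assms]])
  interpret module R M by fact
  show "U +>\<^bsub>M\<^esub> \<zero>\<^bsub>M\<^esub> = \<zero>\<^bsub>quotient_module M U\<^esub>"
    using quotient_module_proj_eq_zero[OF assms] submodule_zero[OF assms] by simp
qed

text \<open>The closure condition is phrased with quotients; in applications an epimorphism is given, and
  the quotient by its kernel is isomorphic to the target.\<close>

lemma closed_under_factor_modulesD:
  fixes \<C> :: "('a, 'm) module set" and Q :: "('a, 'm) module"
  assumes \<C>: "closed_under_factor_modules R \<C>" "M \<in> \<C>" and "module R M" "module R Q"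
    and f: "f \<in> module_epi R M Q"
  shows "Q \<in> \<C>"
proof -
  interpret M: module R M by fact
  interpret Q: module R Q by fact
  have fh: "f \<in> module_hom R M Q" and fim: "f ` carrier M = carrier Q"
    using f by (auto simp: module_epi_def)
  define U where "U = {x \<in> carrier M. f x \<in> {\<zero>\<^bsub>Q\<^esub>}}"
  have U: "submodule U R M"
    unfolding U_def
    by (rule module_hom_preimage_submodule[OF assms(3,4) fh zero_submodule[OF assms(4)]])
  note p = quotient_module_proj[OF assms(3) U]
  have im: "carrier (quotient_module M U) = a_r_coset M U ` carrier M"
    using p by (auto simp: module_epi_def)
  obtain g where g: "g \<in> module_hom R (quotient_module M U) Q"
    and gp: "\<And>x. x \<in> carrier M \<Longrightarrow> g (U +>\<^bsub>M\<^esub> x) = f x"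
    using module_hom_factor_epi[OF assms(3) module_quotient[OF assms(3) U] assms(4) p fh]
      quotient_module_proj_eq_zero[OF assms(3) U] by (auto simp: U_def)
  have ker: "U +>\<^bsub>M\<^esub> x = \<zero>\<^bsub>quotient_module M U\<^esub> \<longleftrightarrow> f x = \<zero>\<^bsub>Q\<^esub>" if "x \<in> carrier M" for x
    using quotient_module_proj_eq_zero[OF assms(3) U that] that by (simp add: U_def)
  have "inj_on g (carrier (quotient_module M U))"
    by (rule module_hom_inj_onI[OF module_quotient[OF assms(3) U] assms(4) g]) (unfold im, elim imageE, simp add: gp ker)
  moreover have "g ` carrier (quotient_module M U) = carrier Q"
    using fim by (auto simp: im gp image_image)
  ultimately have "g \<in> module_iso R (quotient_module M U) Q"
    using g by (simp add: module_iso_def bij_betw_def)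
  then show ?thesis using \<C> U assms(4) unfolding closed_under_factor_modules_def by blast
qed

lemma ideal_module_simps [simp]:
  "carrier (ideal_module R I) = I" "\<zero>\<^bsub>ideal_module R I\<^esub> = \<zero>\<^bsub>R\<^esub>"
  "x \<oplus>\<^bsub>ideal_module R I\<^esub> y = x \<oplus>\<^bsub>R\<^esub> y" "a \<odot>\<^bsub>ideal_module R I\<^esub> x = a \<otimes>\<^bsub>R\<^esub> x"
  by (simp_all add: ideal_module_def)

lemma module_ring_module:
  assumes "cring R" shows "module R (ring_module R)"
proof -
  interpret cring R by fact
  have "abelian_group (ring_module R)"
    by (rule abelian_groupI) (auto simp: a_ac intro: bexI[where x = "\<ominus>\<^bsub>R\<^esub> x" for x] r_neg)
  then show ?thesis
    by (rule moduleI[OF assms]) (simp_all add: m_assoc l_distr r_distr)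
qed

lemma ideal_submodule:
  assumes "cring R" "ideal I R" shows "submodule I R (ring_module R)"
proof -
  interpret R: cring R by fact
  interpret ideal I R by fact
  interpret M: module R "ring_module R" by (rule module_ring_module) fact
  have "\<ominus>\<^bsub>ring_module R\<^esub> a = \<ominus>\<^bsub>R\<^esub> a" if "a \<in> carrier R" for a
    using M.M.minus_equality[of "\<ominus>\<^bsub>R\<^esub> a" a] that by (simp add: R.l_neg)
  then show ?thesis
    by (intro M.submoduleI) (use a_subset in \<open>auto simp: I_l_closed\<close>)
qed

lemma module_ideal_module:
  assumes "cring R" "ideal I R" shows "module R (ideal_module R I)"
proof -
  have "(ring_module R)\<lparr>carrier := I\<rparr> = ideal_module R I" by (simp add: ideal_module_def)
  then show ?thesis
    using submodule_module[OF module_ring_module ideal_submodule] assms by metis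
qed

lemma submodule_ring_module_ideal:
  assumes "cring R" "submodule J R (ring_module R)" shows "ideal J R"
proof -
  interpret R: cring R by fact
  interpret M: module R "ring_module R" by (rule module_ring_module) fact
  have m: "\<ominus>\<^bsub>ring_module R\<^esub> a = \<ominus>\<^bsub>R\<^esub> a" if "a \<in> carrier R" for a
    using M.M.minus_equality[of "\<ominus>\<^bsub>R\<^esub> a" a] that by (simp add: R.l_neg)
  note J = M.submoduleE[OF assms(2)] submodule_zero[OF module_ring_module[OF assms(1)] assms(2)]
  show ?thesis
  proof (rule idealI)
    have "\<ominus>\<^bsub>R\<^esub> a \<in> J" if "a \<in> J" for a
      using J(1) J(3)[OF that] m[of a] that by auto
    then show "subgroup J (add_monoid R)"
      using J(1,5,7) by (auto simp: subgroup_def a_inv_def)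
    show "a \<otimes>\<^bsub>R\<^esub> x \<in> J" "x \<otimes>\<^bsub>R\<^esub> a \<in> J" if "a \<in> J" "x \<in> carrier R" for a x
      using J(1) J(4)[of x a] that R.m_comm[of a x] by auto
  qed (rule R.ring_axioms)
qed

text \<open>This is what keeps finite powers inside the universe; it rests on \<open>\<kappa> \<cdot> \<kappa> = \<kappa>\<close> for infinite
  cardinals.\<close>

lemma finite_PiE_lepoll:
  assumes "finite \<Lambda>" "infinite (UNIV :: 'm set)" "C \<lesssim> (UNIV :: 'm set)"
  shows "(\<Lambda> \<rightarrow>\<^sub>E C) \<lesssim> (UNIV :: 'm set)"
  using assms(1)
proof (induction \<Lambda> rule: finite_induct)
  case empty
  then show ?case by (simp add: finite_lepoll_infinite assms(2))
next
  case (insert l \<Lambda>)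
  have "inj_on (\<lambda>u. (u l, restrict u \<Lambda>)) (insert l \<Lambda> \<rightarrow>\<^sub>E C)"
  proof (rule inj_onI)
    fix u v assume uv: "u \<in> insert l \<Lambda> \<rightarrow>\<^sub>E C" "v \<in> insert l \<Lambda> \<rightarrow>\<^sub>E C"
      "(u l, restrict u \<Lambda>) = (v l, restrict v \<Lambda>)"
    show "u = v"
      by (rule PiE_ext[OF uv(1,2)]) (use uv(3) in \<open>auto simp: restrict_eq_iff\<close>)
  qed
  then have "(insert l \<Lambda> \<rightarrow>\<^sub>E C) \<lesssim> C \<times> (\<Lambda> \<rightarrow>\<^sub>E C)"
    by (auto simp: lepoll_def intro!: exI[of _ "\<lambda>u. (u l, restrict u \<Lambda>)"])
  also have "\<dots> \<lesssim> (UNIV :: 'm set) \<times> (UNIV :: 'm set)"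
    by (rule times_lepoll_mono[OF assms(3) insert.IH])
  also have "\<dots> \<lesssim> (UNIV :: 'm set)"
    using card_of_Times_same_infinite[OF assms(2)]
    unfolding lepoll_def card_of_ordLeq by (simp add: ordIso_iff_ordLeq)
  finally show ?case .
qed

lemma module_copy_exists:
  assumes "module R N" "carrier N \<lesssim> (UNIV :: 'm set)"
  shows "\<exists>(M :: ('a, 'm) module) \<theta>. module R M \<and> \<theta> \<in> module_iso R N M"
proof -
  interpret N: module R N by fact
  obtain \<theta> :: "_ \<Rightarrow> 'm" where \<theta>: "inj_on \<theta> (carrier N)" using assms(2) by (auto simp: lepoll_def)
  define \<psi> where "\<psi> = inv_into (carrier N) \<theta>"
  have \<psi>: "\<psi> (\<theta> x) = x" if "x \<in> carrier N" for x using \<theta> that by (simp add: \<psi>_def)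
  define M :: "('a, 'm) module" where "M =
    \<lparr>carrier = \<theta> ` carrier N, monoid.mult = undefined, one = undefined, ring.zero = \<theta> \<zero>\<^bsub>N\<^esub>,
     ring.add = (\<lambda>x y. \<theta> (\<psi> x \<oplus>\<^bsub>N\<^esub> \<psi> y)), smult = (\<lambda>a x. \<theta> (a \<odot>\<^bsub>N\<^esub> \<psi> x))\<rparr>"
  have "\<theta> \<in> module_iso R N M"
    using \<theta> by (auto simp: module_iso_def M_def \<psi> bij_betw_def intro!: module_homI)
  moreover from this have "module R M"
    by (intro module_surjective_image[OF assms(1) module_iso_epi]) (auto simp: M_def)
  ultimately show ?thesis by blast
qed

section \<open>Generation and cogeneration in terms of homomorphisms\<close>

text \<open>The image of a direct sum of copies of \<open>G\<close> is the sum of the images of its summands, so a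
  module generated by \<open>G\<close> equals its trace, the smallest submodule containing the images of all
  homomorphisms from \<open>G\<close>.\<close>

lemma generated_byD:
  fixes G :: "('a, 'g, 'x) module_scheme" and M :: "('a, 'm, 'y) module_scheme"
  assumes "module R G" "module R M" and gen: "generated_by R G M"
    and V: "submodule V R M" "\<And>h. h \<in> module_hom R G M \<Longrightarrow> h ` carrier G \<subseteq> V"
  shows "V = carrier M"
proof
  interpret G: module R G by fact
  interpret M: module R M by fact
  show "V \<subseteq> carrier M" using M.submoduleE[OF V(1)] by simp
  from gen obtain \<Lambda> :: "('g \<Rightarrow> 'm) set" and F
    where F: "F \<in> module_hom R (copower_module \<Lambda> G) M"
      and im: "F ` carrier (copower_module \<Lambda> G) = carrier M"
    unfolding generated_by_def module_epi_def by blast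
  show "carrier M \<subseteq> V"
  proof
    fix x assume "x \<in> carrier M"
    then obtain u where u: "u \<in> carrier (copower_module \<Lambda> G)" "x = F u" using im by blast
    let ?S = "{l \<in> \<Lambda>. u l \<noteq> \<zero>\<^bsub>G\<^esub>}"
    have S: "finite ?S" and uG: "\<And>l. l \<in> \<Lambda> \<Longrightarrow> u l \<in> carrier G"
      using u by (auto simp: copower_module_simps)
    have "F (summand_map \<Lambda> G l (u l)) \<in> V" if "l \<in> ?S" for l
      using V(2)[OF module_hom_comp[OF summand_map_hom[OF assms(1)] F]] uG that by auto
    then have "(\<Oplus>\<^bsub>M\<^esub>l\<in>?S. F (summand_map \<Lambda> G l (u l))) \<in> V"
      using submodule_finsum[OF assms(2) V(1) S] by auto
    moreover have "F u = (\<Oplus>\<^bsub>M\<^esub>l\<in>?S. F (summand_map \<Lambda> G l (u l)))"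
      by (rule hom_copower_expand[OF assms(1,2) F S _ u(1)]) auto
    ultimately show "x \<in> V" using u(2) by simp
  qed
qed

text \<open>The index set is the set of all homomorphisms, and the epimorphism is evaluation.\<close>

lemma generated_by_homsI:
  fixes G :: "('a, 'g, 'x) module_scheme" and M :: "('a, 'm, 'y) module_scheme"
  assumes "module R G" "module R M"
    and hit: "\<And>x. x \<in> carrier M \<Longrightarrow> \<exists>h\<in>module_hom R G M. x \<in> h ` carrier G"
  shows "generated_by R G M"
proof -
  obtain F where F: "F \<in> module_hom R (copower_module (module_hom R G M) G) M"
    and Fs: "\<And>h y. h \<in> module_hom R G M \<Longrightarrow> y \<in> carrier G \<Longrightarrow>
      F (summand_map (module_hom R G M) G h y) = h y"
    using hom_copower_exists[OF assms(1,2), of "module_hom R G M" "\<lambda>h. h"] by blast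
  have "carrier M \<subseteq> F ` carrier (copower_module (module_hom R G M) G)"
  proof
    fix x assume "x \<in> carrier M"
    then obtain h y where "h \<in> module_hom R G M" "y \<in> carrier G" "x = h y" using hit by blast
    then show "x \<in> F ` carrier (copower_module (module_hom R G M) G)"
      using Fs summand_map_closed[OF assms(1)] by (metis imageI)
  qed
  with F show ?thesis
    unfolding generated_by_def module_epi_def using module_hom_closed[OF F] by blast
qed

lemma extensional_neq_constE:
  assumes "u \<in> extensional A" "u \<noteq> (\<lambda>x\<in>A. c)"
  obtains x where "x \<in> A" "u x \<noteq> c"
  using assms by (metis extensionalityI restrict_apply' restrict_extensional)

text \<open>A module embeds into a power of \<open>C\<close> if and only if its homomorphisms to \<open>C\<close> separate points,
  because then evaluation at all of them is injective.\<close>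

lemma cogenerated_by_iff_homs:
  fixes C :: "('a, 'c, 'x) module_scheme" and M :: "('a, 'm, 'y) module_scheme"
  assumes "module R C" "module R M"
  shows "cogenerated_by R C M \<longleftrightarrow>
    (\<forall>x\<in>carrier M. x \<noteq> \<zero>\<^bsub>M\<^esub> \<longrightarrow> (\<exists>h\<in>module_hom R M C. h x \<noteq> \<zero>\<^bsub>C\<^esub>))"
proof
  assume "cogenerated_by R C M"
  then obtain \<Lambda> :: "('m \<Rightarrow> 'c) set" and f
    where f: "f \<in> module_hom R M (power_module \<Lambda> C)" "inj_on f (carrier M)"
    unfolding cogenerated_by_def module_mono_def by blast
  interpret M: module R M by fact
  show "\<forall>x\<in>carrier M. x \<noteq> \<zero>\<^bsub>M\<^esub> \<longrightarrow> (\<exists>h\<in>module_hom R M C. h x \<noteq> \<zero>\<^bsub>C\<^esub>)"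
  proof (intro ballI impI)
    fix x assume x: "x \<in> carrier M" "x \<noteq> \<zero>\<^bsub>M\<^esub>"
    then have "f x \<noteq> \<zero>\<^bsub>power_module \<Lambda> C\<^esub>"
      using f(2) module_hom_zero[OF assms(2) module_power[OF assms(1)] f(1)]
      by (metis M.M.zero_closed inj_onD)
    moreover have "f x \<in> \<Lambda> \<rightarrow>\<^sub>E carrier C"
      using module_hom_closed[OF f(1) x(1)] by (simp add: power_module_simps)
    ultimately obtain l where "l \<in> \<Lambda>" "f x l \<noteq> \<zero>\<^bsub>C\<^esub>"
      by (auto simp: power_module_simps PiE_def elim: extensional_neq_constE)
    then show "\<exists>h\<in>module_hom R M C. h x \<noteq> \<zero>\<^bsub>C\<^esub>"
      by (intro bexI[of _ "\<lambda>y. f y l"] module_hom_comp[OF f(1) power_proj_hom])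
  qed
next
  assume sep: "\<forall>x\<in>carrier M. x \<noteq> \<zero>\<^bsub>M\<^esub> \<longrightarrow> (\<exists>h\<in>module_hom R M C. h x \<noteq> \<zero>\<^bsub>C\<^esub>)"
  let ?f = "\<lambda>x. \<lambda>h\<in>module_hom R M C. h x"
  have f: "?f \<in> module_hom R M (power_module (module_hom R M C) C)"
    by (rule hom_into_power)
  have "inj_on ?f (carrier M)"
    by (rule module_hom_inj_onI[OF assms(2) module_power[OF assms(1)] f])
      (use sep in \<open>auto simp: power_module_simps restrict_eq_iff\<close>)
  with f show "cogenerated_by R C M"
    unfolding cogenerated_by_def module_mono_def by blast
qed

lemma cogenerated_by_power:
  assumes "module R C" "module R N" "cogenerated_by R C N"
  shows "cogenerated_by R C (power_module \<Lambda> N)"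
  unfolding cogenerated_by_iff_homs[OF assms(1) module_power[OF assms(2)]]
proof (intro ballI impI)
  fix u assume u: "u \<in> carrier (power_module \<Lambda> N)" "u \<noteq> \<zero>\<^bsub>power_module \<Lambda> N\<^esub>"
  then obtain l where l: "l \<in> \<Lambda>" "u l \<noteq> \<zero>\<^bsub>N\<^esub>"
    by (auto simp: power_module_simps PiE_def elim: extensional_neq_constE)
  moreover have "u l \<in> carrier N" using u(1) l by (auto simp: power_module_simps)
  ultimately obtain h where "h \<in> module_hom R N C" "h (u l) \<noteq> \<zero>\<^bsub>C\<^esub>"
    using assms(3) unfolding cogenerated_by_iff_homs[OF assms(1,2)] by blast
  then show "\<exists>h\<in>module_hom R (power_module \<Lambda> N) C. h u \<noteq> \<zero>\<^bsub>C\<^esub>"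
    by (intro bexI[of _ "\<lambda>u. h (u l)"] module_hom_comp[OF power_proj_hom[OF l(1)]])
qed

lemma cogenerated_by_iso:
  assumes "module R C" "module R N" "module R M" "cogenerated_by R C N" "\<theta> \<in> module_iso R N M"
  shows "cogenerated_by R C M"
  unfolding cogenerated_by_iff_homs[OF assms(1,3)]
proof (intro ballI impI)
  fix x assume x: "x \<in> carrier M" "x \<noteq> \<zero>\<^bsub>M\<^esub>"
  obtain g where g: "g \<in> module_hom R M N" "\<theta> (g x) = x"
    using module_iso_inverse[OF assms(2,5)] module_iso_hom x(1) by metis
  then have "g x \<noteq> \<zero>\<^bsub>N\<^esub>"
    using x(2) module_hom_zero[OF assms(2,3) module_iso_hom[OF assms(5)]] by metis
  then obtain h where "h \<in> module_hom R N C" "h (g x) \<noteq> \<zero>\<^bsub>C\<^esub>"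
    using assms(4) module_hom_closed[OF g(1) x(1)] unfolding cogenerated_by_iff_homs[OF assms(1,2)]
    by blast
  then show "\<exists>h\<in>module_hom R M C. h x \<noteq> \<zero>\<^bsub>C\<^esub>"
    by (intro bexI[of _ "\<lambda>y. h (g y)"] module_hom_comp[OF g(1)])
qed

lemma hom_module_simps:
  "carrier (hom_module R M N) = module_hom R M N \<inter> extensional (carrier M)"
  "\<zero>\<^bsub>hom_module R M N\<^esub> = (\<lambda>x\<in>carrier M. \<zero>\<^bsub>N\<^esub>)"
  "f \<oplus>\<^bsub>hom_module R M N\<^esub> g = (\<lambda>x\<in>carrier M. f x \<oplus>\<^bsub>N\<^esub> g x)"
  "a \<odot>\<^bsub>hom_module R M N\<^esub> f = (\<lambda>x\<in>carrier M. a \<odot>\<^bsub>N\<^esub> f x)"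
  by (simp_all add: hom_module_def)

lemma module_hom_module:
  assumes "module R M" "module R N" shows "module R (hom_module R M N)"
proof -
  interpret M: module R M by fact
  interpret N: module R N by fact
  let ?P = "power_module (carrier M) N"
  interpret P: module R ?P by (rule module_power) fact
  let ?H = "module_hom R M N \<inter> extensional (carrier M)"
  have PiE: "f \<in> ?H \<Longrightarrow> f \<in> carrier M \<rightarrow>\<^sub>E carrier N" for f
    by (auto simp: PiE_def module_hom_def)
  have restr: "restrict f (carrier M) \<in> ?H" if "f \<in> module_hom R M N" for f
    using that by (auto simp: module_hom_def)
  have sm: "(\<lambda>x. a \<odot>\<^bsub>N\<^esub> f x) \<in> module_hom R M N" if "a \<in> carrier R" "f \<in> module_hom R M N" for a f
  proof (rule module_homI)
    fix b x assume b: "b \<in> carrier R" "x \<in> carrier M"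
    then have "a \<odot>\<^bsub>N\<^esub> (b \<odot>\<^bsub>N\<^esub> f x) = b \<odot>\<^bsub>N\<^esub> (a \<odot>\<^bsub>N\<^esub> f x)"
      using that module_hom_closed[OF that(2) b(2)]
      by (simp add: N.smult_assoc1[symmetric] M.R.m_comm)
    then show "a \<odot>\<^bsub>N\<^esub> f (b \<odot>\<^bsub>M\<^esub> x) = b \<odot>\<^bsub>N\<^esub> (a \<odot>\<^bsub>N\<^esub> f x)"
      using b module_hom_smult[OF that(2)] by simp
  qed (use that in \<open>simp_all add: module_hom_closed[OF that(2)] module_hom_add[OF that(2)] N.smult_r_distr\<close>)
  have sub: "submodule ?H R ?P"
  proof (rule P.submoduleI)
    show "?H \<subseteq> carrier ?P" using PiE by (auto simp: power_module_simps)
    show "\<zero>\<^bsub>?P\<^esub> \<in> ?H" by (auto simp: power_module_simps module_hom_def)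
    show add: "f \<oplus>\<^bsub>?P\<^esub> g \<in> ?H" if "f \<in> ?H" "g \<in> ?H" for f g
      using restr[OF module_hom_pointwise_add[OF assms(2)]] that by (simp add: power_module_simps)
    show smult: "a \<odot>\<^bsub>?P\<^esub> f \<in> ?H" if "a \<in> carrier R" "f \<in> ?H" for a f
      using restr[OF sm] that by (simp add: power_module_simps)
    fix f assume f: "f \<in> ?H"
    have "\<ominus>\<^bsub>?P\<^esub> f = (\<ominus>\<^bsub>R\<^esub> \<one>\<^bsub>R\<^esub>) \<odot>\<^bsub>?P\<^esub> f"
      using PiE[OF f] by (simp add: P.smult_l_minus power_module_simps(1))
    then show "\<ominus>\<^bsub>?P\<^esub> f \<in> ?H" using smult[OF _ f] by simp
  qed
  have "?P\<lparr>carrier := ?H\<rparr> = hom_module R M N" by (simp add: power_module_def hom_module_def)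
  then show ?thesis using submodule_module[OF module_power[OF assms(2)] sub] by metis
qed

text \<open>By the adjunction between tensor products and \<open>Hom\<close>, a homomorphism \<open>M \<rightarrow> Hom(L, E)\<close> is a
  bilinear map \<open>M \<times> L \<rightarrow> E\<close>.\<close>

lemma cogenerated_by_hom_module_iff:
  assumes "module R L" "module R E" "module R M"
  shows "cogenerated_by R (hom_module R L E) M \<longleftrightarrow>
    (\<forall>x\<in>carrier M. x \<noteq> \<zero>\<^bsub>M\<^esub> \<longrightarrow>
      (\<exists>\<beta>. (\<forall>i\<in>carrier L. (\<lambda>x. \<beta> x i) \<in> module_hom R M E) \<and>
           (\<forall>x\<in>carrier M. \<beta> x \<in> module_hom R L E) \<and> (\<exists>i\<in>carrier L. \<beta> x i \<noteq> \<zero>\<^bsub>E\<^esub>)))"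
    (is "_ \<longleftrightarrow> (\<forall>x\<in>carrier M. x \<noteq> \<zero>\<^bsub>M\<^esub> \<longrightarrow> ?Q x)")
proof -
  let ?H = "hom_module R L E"
  have "(\<exists>h\<in>module_hom R M ?H. h x \<noteq> \<zero>\<^bsub>?H\<^esub>) \<longleftrightarrow> ?Q x" if x: "x \<in> carrier M" for x
  proof
    assume "\<exists>h\<in>module_hom R M ?H. h x \<noteq> \<zero>\<^bsub>?H\<^esub>"
    then obtain h where h: "h \<in> module_hom R M ?H" "h x \<noteq> \<zero>\<^bsub>?H\<^esub>" by blast
    have hH: "h y \<in> module_hom R L E" "h y \<in> extensional (carrier L)" if "y \<in> carrier M" for y
      using module_hom_closed[OF h(1) that] by (auto simp: hom_module_simps)
    have "(\<lambda>x. h x i) \<in> module_hom R M E" if "i \<in> carrier L" for i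
      by (rule module_homI)
        (use that in \<open>simp_all add: module_hom_closed[OF hH(1)] module_hom_add[OF h(1)]
           module_hom_smult[OF h(1)] hom_module_simps\<close>)
    moreover have "\<exists>i\<in>carrier L. h x i \<noteq> \<zero>\<^bsub>E\<^esub>"
      using h(2) hH(2)[OF x] by (auto simp: hom_module_simps elim: extensional_neq_constE)
    ultimately show "?Q x" using hH(1) by blast
  next
    assume "?Q x"
    then obtain \<beta> i where \<beta>: "\<And>i. i \<in> carrier L \<Longrightarrow> (\<lambda>x. \<beta> x i) \<in> module_hom R M E"
      "\<And>x. x \<in> carrier M \<Longrightarrow> \<beta> x \<in> module_hom R L E" and i: "i \<in> carrier L" "\<beta> x i \<noteq> \<zero>\<^bsub>E\<^esub>" by blast
    have "(\<lambda>x. restrict (\<beta> x) (carrier L)) \<in> module_hom R M ?H"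
    proof (rule module_homI)
      fix y assume "y \<in> carrier M"
      then show "restrict (\<beta> y) (carrier L) \<in> carrier ?H"
        using \<beta>(2)[OF \<open>y \<in> carrier M\<close>] module.smult_closed[OF assms(1)]
          abelian_monoid.a_closed[of L] assms(1)
        by (auto simp: hom_module_simps module_hom_def module_def abelian_group_def)
    qed (auto simp: hom_module_simps restrict_eq_iff module_hom_add[OF \<beta>(1)] module_hom_smult[OF \<beta>(1)])
    moreover have "restrict (\<beta> x) (carrier L) \<noteq> \<zero>\<^bsub>?H\<^esub>"
      using i by (auto simp: hom_module_simps restrict_eq_iff)
    ultimately show "\<exists>h\<in>module_hom R M ?H. h x \<noteq> \<zero>\<^bsub>?H\<^esub>"
      by (intro bexI[of _ "\<lambda>x. restrict (\<beta> x) (carrier L)"])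
  qed
  then show ?thesis
    using cogenerated_by_iff_homs[OF module_hom_module[OF assms(1,2)] assms(3)] by blast
qed

section \<open>Injective modules over a local ring\<close>

text \<open>The definition of injectivity speaks about modules in the universe of \<open>E\<close>; replacing \<open>B\<close> by a
  copy carries it over to all modules that are small enough.\<close>

lemma injective_extension:
  fixes E :: "('a, 'm) module"
  assumes inj: "injective_module R E" and B: "module R B" "carrier B \<lesssim> (UNIV :: 'm set)"
    and A: "submodule A R B" and f: "f \<in> module_hom R (B\<lparr>carrier := A\<rparr>) E"
  shows "\<exists>g\<in>module_hom R B E. \<forall>x\<in>A. g x = f x"
proof -
  interpret B: module R B by fact
  have AB: "A \<subseteq> carrier B" using B.submoduleE[OF A] by simp
  obtain M :: "('a, 'm) module" and \<theta> where M: "module R M" and \<theta>: "\<theta> \<in> module_iso R B M"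
    using module_copy_exists[OF B] by blast
  note \<theta>h = module_iso_hom[OF \<theta>]
  obtain \<rho> where \<rho>: "\<rho> \<in> module_iso R M B" "\<forall>x\<in>carrier B. \<rho> (\<theta> x) = x"
    using module_iso_inverse[OF B(1) \<theta>] by blast
  note \<rho>h = module_iso_hom[OF \<rho>(1)]
  have sub: "submodule (\<theta> ` A) R M" by (rule module_hom_image_submodule[OF B(1) M \<theta>h A])
  let ?A = "M\<lparr>carrier := \<theta> ` A\<rparr>"
  have A'M: "\<theta> ` A \<subseteq> carrier M" using AB module_hom_closed[OF \<theta>h] by auto
  have "(\<lambda>x. x) \<in> module_mono R ?A M"
    using A'M by (auto simp: module_mono_def intro!: module_homI)
  moreover have "\<rho> \<in> module_hom R ?A (B\<lparr>carrier := A\<rparr>)"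
    by (rule module_homI)
      (use A'M AB in \<open>auto simp: \<rho>(2) subset_iff module_hom_add[OF \<rho>h] module_hom_smult[OF \<rho>h]\<close>)
  then have "(\<lambda>x. f (\<rho> x)) \<in> module_hom R ?A E" using f by (rule module_hom_comp)
  ultimately have "\<exists>g\<in>module_hom R M E. \<forall>x\<in>carrier ?A. g x = f (\<rho> x)"
    using inj[unfolded injective_module_def, THEN conjunct2, rule_format, OF submodule_module[OF M sub] M]
    by simp
  then obtain g where g: "g \<in> module_hom R M E" "\<forall>x\<in>\<theta> ` A. g x = f (\<rho> x)" by auto
  have "\<forall>x\<in>A. g (\<theta> x) = f x" using g(2) \<rho>(2) AB by auto
  then show ?thesis by (intro bexI[of _ "\<lambda>x. g (\<theta> x)"] module_hom_comp[OF \<theta>h g(1)])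
qed

lemma ring_smult_hom:
  assumes "module R M" "x \<in> carrier M"
  shows "(\<lambda>r. r \<odot>\<^bsub>M\<^esub> x) \<in> module_hom R (ring_module R) M"
proof -
  interpret module R M by fact
  show ?thesis
    by (rule module_homI) (use assms(2) in \<open>simp_all add: smult_l_distr smult_assoc1\<close>)
qed

lemma smult_hom:
  assumes "module R M" "c \<in> carrier R"
  shows "(\<lambda>x. c \<odot>\<^bsub>M\<^esub> x) \<in> module_hom R M M"
proof -
  interpret M: module R M by fact
  show ?thesis
    by (rule module_homI)
      (use assms(2) in \<open>simp_all add: M.smult_r_distr M.smult_assoc1[symmetric] M.R.m_comm\<close>)
qed

lemma quotient_ring_hom:
  assumes "module R M" "ideal J R" "x \<in> carrier M" "\<And>c. c \<in> J \<Longrightarrow> c \<odot>\<^bsub>M\<^esub> x = \<zero>\<^bsub>M\<^esub>"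
  shows "\<exists>g\<in>module_hom R (quotient_module (ring_module R) J) M.
    \<forall>r\<in>carrier R. g (J +>\<^bsub>ring_module R\<^esub> r) = r \<odot>\<^bsub>M\<^esub> x"
proof -
  interpret M: module R M by fact
  note R = module_ring_module[OF M.R.is_cring] and J = ideal_submodule[OF M.R.is_cring assms(2)]
  show ?thesis
    using module_hom_factor_epi[OF R module_quotient[OF R J] assms(1) quotient_module_proj[OF R J]
        ring_smult_hom[OF assms(1,3)]] assms(4) quotient_module_proj_eq_zero[OF R J]
    by auto
qed

text \<open>Noetherianity makes the union of a chain of ideals a member of the chain, so Zorn's lemma
  applies at once.\<close>

lemma (in noetherian_ring) proper_ideal_subset_maximal:
  assumes "ideal J R" "J \<noteq> carrier R"
  shows "\<exists>\<mm>. maximalideal \<mm> R \<and> J \<subseteq> \<mm>"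
proof -
  let ?S = "{K. ideal K R \<and> J \<subseteq> K \<and> \<one> \<notin> K}"
  have J1: "\<one> \<notin> J" using assms ideal.one_imp_carrier by blast
  have "\<exists>K\<in>?S. \<forall>L\<in>?S. K \<subseteq> L \<longrightarrow> L = K"
  proof (rule subset_Zorn)
    fix \<C> assume C: "subset.chain ?S \<C>"
    show "\<exists>U\<in>?S. \<forall>K\<in>\<C>. K \<subseteq> U"
    proof (cases "\<C> = {}")
      case True
      then show ?thesis using assms(1) J1 by auto
    next
      case False
      have "subset.chain {K. ideal K R} \<C>" using C by (auto simp: subset.chain_def)
      then have "\<Union>\<C> \<in> \<C>" using False by (intro ideal_chain_is_trivial)
      then show ?thesis using C by (intro bexI[of _ "\<Union>\<C>"]) (auto simp: subset.chain_def)
    qed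
  qed
  then obtain K where "K \<in> ?S" and max: "\<forall>L\<in>?S. K \<subseteq> L \<longrightarrow> L = K" ..
  then have K: "ideal K R" "J \<subseteq> K" "\<one> \<notin> K" by auto
  have "maximalideal K R"
  proof (rule maximalidealI)
    fix L assume L: "ideal L R" "K \<subseteq> L" "L \<subseteq> carrier R"
    show "L = K \<or> L = carrier R"
    proof (cases "\<one> \<in> L")
      case True
      then show ?thesis using ideal.one_imp_carrier[OF L(1)] by simp
    next
      case False
      then have "L \<in> ?S" using L K(2) by auto
      then show ?thesis using max L(2) by blast
    qed
  qed (use K in auto)
  with K(2) show ?thesis by blast
qed

text \<open>The principal ideal of \<open>r\<close> lies in no maximal ideal, since \<open>\<mm>\<close> is the only one.\<close>

lemma local_ring_unit:
  assumes loc: "local_ring R \<mm>" and "noetherian_ring R" and r: "r \<in> carrier R" "r \<notin> \<mm>"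
  shows "\<exists>r'\<in>carrier R. r' \<otimes>\<^bsub>R\<^esub> r = \<one>\<^bsub>R\<^esub>"
proof -
  interpret cring R using loc by (simp add: local_ring_def)
  interpret N: noetherian_ring R by fact
  have "PIdl\<^bsub>R\<^esub> r = carrier R"
  proof (rule ccontr)
    assume "PIdl\<^bsub>R\<^esub> r \<noteq> carrier R"
    then obtain \<nn> where "maximalideal \<nn> R" "PIdl\<^bsub>R\<^esub> r \<subseteq> \<nn>"
      using N.proper_ideal_subset_maximal[OF cgenideal_ideal[OF r(1)]] by blast
    then show False using loc cgenideal_self[OF r(1)] r(2) by (auto simp: local_ring_def)
  qed
  then have "\<one>\<^bsub>R\<^esub> \<in> PIdl\<^bsub>R\<^esub> r" by simp
  then show ?thesis by (auto simp: cgenideal_def)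
qed

text \<open>The witness is the image of \<open>1 + \<mm>\<close> under the embedding of the residue field.\<close>

lemma injective_hull_residue_field:
  assumes loc: "local_ring R \<mm>"
    and hull: "injective_hull R (quotient_module (ring_module R) \<mm>) E"
  obtains s where "s \<in> carrier E" "s \<noteq> \<zero>\<^bsub>E\<^esub>" "\<And>r. r \<in> \<mm> \<Longrightarrow> r \<odot>\<^bsub>E\<^esub> s = \<zero>\<^bsub>E\<^esub>"
proof -
  interpret cring R using loc by (simp add: local_ring_def)
  interpret \<mm>: maximalideal \<mm> R using loc by (simp add: local_ring_def)
  let ?k = "quotient_module (ring_module R) \<mm>"
  note R = module_ring_module[OF is_cring]
  note m = ideal_submodule[OF is_cring \<mm>.is_ideal]
  note k = module_quotient[OF R m]
  have E: "module R E" using hull by (simp add: injective_hull_def injective_module_def)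
  obtain j where j: "j \<in> module_hom R ?k E" "inj_on j (carrier ?k)"
    using hull by (auto simp: injective_hull_def module_mono_def)
  have p: "a_r_coset (ring_module R) \<mm> \<in> module_hom R (ring_module R) ?k"
    using quotient_module_proj[OF R m] by (simp add: module_epi_def)
  note jp = module_hom_comp[OF p j(1)]
  let ?s = "j (\<mm> +>\<^bsub>ring_module R\<^esub> \<one>\<^bsub>R\<^esub>)"
  have rs: "r \<odot>\<^bsub>E\<^esub> ?s = j (\<mm> +>\<^bsub>ring_module R\<^esub> r)" if "r \<in> carrier R" for r
    using module_hom_smult[OF jp that, of "\<one>\<^bsub>R\<^esub>"] that by simp
  have "\<one>\<^bsub>R\<^esub> \<notin> \<mm>" using \<mm>.I_notcarr \<mm>.one_imp_carrier by blast
  then have "\<mm> +>\<^bsub>ring_module R\<^esub> \<one>\<^bsub>R\<^esub> \<noteq> \<zero>\<^bsub>?k\<^esub>"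
    using quotient_module_proj_eq_zero[OF R m, of "\<one>\<^bsub>R\<^esub>"] by simp
  then have "?s \<noteq> \<zero>\<^bsub>E\<^esub>"
    using j(2) module_hom_zero[OF k E j(1)] module_hom_closed[OF p, of "\<one>\<^bsub>R\<^esub>"]
      abelian_monoid.zero_closed[of ?k] k
    by (auto simp: inj_on_def module_def abelian_group_def)
  moreover have "r \<odot>\<^bsub>E\<^esub> ?s = \<zero>\<^bsub>E\<^esub>" if "r \<in> \<mm>" for r
    using quotient_module_proj_eq_zero[OF R m, of r] that rs[of r] module_hom_zero[OF k E j(1)]
      \<mm>.a_subset by auto
  moreover have "?s \<in> carrier E" using module_hom_closed[OF jp, of "\<one>\<^bsub>R\<^esub>"] by simp
  ultimately show ?thesis using that by blast
qed

section \<open>Submodules of finite free modules over a noetherian ring\<close>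

lemma submodule_Int:
  assumes "module R M" "submodule U R M" "submodule V R M"
  shows "submodule (U \<inter> V) R M"
proof -
  interpret module R M by fact
  show ?thesis
    by (rule submoduleI)
      (use submoduleE[OF assms(2)] submoduleE[OF assms(3)] submodule_zero[OF assms(1)] assms in auto)
qed

text \<open>Finite generation of \<open>K\<close> is expressed by its universal property: every submodule that
  contains \<open>T\<close> contains \<open>K\<close>. The proof is by induction on the set of coordinates on which \<open>K\<close> is
  allowed to be nonzero. For a new coordinate \<open>a\<close>, the \<open>a\<close>-th entries of \<open>K\<close> form an ideal; lifts
  of finitely many generators of it, together with generators of the elements of \<open>K\<close> whose
  \<open>a\<close>-th entry vanishes, generate \<open>K\<close>.\<close>

lemma finite_free_submodule_fg:
  fixes R :: "('a, 'b) ring_scheme" and X :: "'x set"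
  defines "F \<equiv> power_module X (ring_module R)"
  assumes "cring R" "noetherian_ring R" "finite X" "submodule K R F"
  shows "\<exists>T\<subseteq>K. finite T \<and> (\<forall>V. submodule V R F \<longrightarrow> T \<subseteq> V \<longrightarrow> K \<subseteq> V)"
proof -
  interpret R: cring R by fact
  interpret N: noetherian_ring R by fact
  note RM = module_ring_module[OF assms(2)]
  have F: "module R F" unfolding F_def by (rule module_power[OF RM])
  interpret F: module R F by fact
  have step: "\<exists>T\<subseteq>K. finite T \<and> (\<forall>V. submodule V R F \<longrightarrow> T \<subseteq> V \<longrightarrow> K \<subseteq> V)"
    if "finite S" "S \<subseteq> X" "submodule K R F" "\<And>u x. u \<in> K \<Longrightarrow> x \<in> X - S \<Longrightarrow> u x = \<zero>\<^bsub>R\<^esub>" for S K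
    using that
  proof (induction S arbitrary: K rule: finite_induct)
    case empty
    have "K \<subseteq> {\<zero>\<^bsub>F\<^esub>}"
    proof
      fix u assume u: "u \<in> K"
      then have "u \<in> X \<rightarrow>\<^sub>E carrier R"
        using F.submoduleE(1)[OF empty(2)] by (auto simp: F_def power_module_simps)
      then have "u = (\<lambda>x\<in>X. \<zero>\<^bsub>R\<^esub>)"
        using empty(3)[OF u] by (intro extensionalityI[of u X]) (auto simp: PiE_def)
      then show "u \<in> {\<zero>\<^bsub>F\<^esub>}" by (simp add: F_def power_module_simps)
    qed
    then show ?case using submodule_zero[OF F] by (intro exI[of _ "{}"]) auto
  next
    case (insert a S)
    have a: "a \<in> X" using insert.prems by simp
    let ?\<pi> = "\<lambda>u. u a"
    have \<pi>: "?\<pi> \<in> module_hom R F (ring_module R)"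
      unfolding F_def by (rule power_proj_hom[OF a])
    have img: "ideal (?\<pi> ` V) R" if "submodule V R F" for V
      by (rule submodule_ring_module_ideal[OF assms(2) module_hom_image_submodule[OF F RM \<pi> that]])
    obtain A where A: "A \<subseteq> carrier R" "finite A" "?\<pi> ` K = Idl\<^bsub>R\<^esub> A"
      using N.finetely_gen[OF img[OF insert.prems(2)]] by blast
    obtain L where L: "L \<subseteq> K" "finite L" "A = ?\<pi> ` L"
      using finite_subset_image[OF A(2), of ?\<pi> K] A(3) R.genideal_self[OF A(1)] by auto
    let ?Z = "{u \<in> carrier F. u a \<in> {\<zero>\<^bsub>ring_module R\<^esub>}}"
    have Z: "submodule ?Z R F"
      by (rule module_hom_preimage_submodule[OF F RM \<pi> zero_submodule[OF RM]])
    have K0: "submodule (K \<inter> ?Z) R F" by (rule submodule_Int[OF F insert.prems(2) Z])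
    have "\<exists>T\<subseteq>K \<inter> ?Z. finite T \<and> (\<forall>V. submodule V R F \<longrightarrow> T \<subseteq> V \<longrightarrow> K \<inter> ?Z \<subseteq> V)"
    proof (rule insert.IH)
      fix u x assume "u \<in> K \<inter> ?Z" "x \<in> X - S"
      then show "u x = \<zero>\<^bsub>R\<^esub>" using insert.prems(3)[of u x] by (cases "x = a") auto
    qed (use insert.prems(1) K0 in auto)
    then obtain T where T: "T \<subseteq> K \<inter> ?Z" "finite T"
      "\<forall>V. submodule V R F \<longrightarrow> T \<subseteq> V \<longrightarrow> K \<inter> ?Z \<subseteq> V"
      by (elim exE conjE)
    have "K \<subseteq> V" if V: "submodule V R F" "T \<union> L \<subseteq> V" for V
    proof
      fix u assume u: "u \<in> K"
      have "ideal (?\<pi> ` (K \<inter> V)) R"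
        by (rule img[OF submodule_Int[OF F insert.prems(2) V(1)]])
      moreover have "A \<subseteq> ?\<pi> ` (K \<inter> V)" using L V(2) by auto
      ultimately have "?\<pi> ` K \<subseteq> ?\<pi> ` (K \<inter> V)"
        unfolding A(3) by (rule R.genideal_minimal)
      then have "u a \<in> ?\<pi> ` (K \<inter> V)" using u by blast
      then obtain v where v: "v \<in> K" "v \<in> V" "v a = u a" by auto
      have cK: "K \<subseteq> carrier F" using F.submoduleE(1)[OF insert.prems(2)] .
      then have cu: "u \<in> carrier F" "v \<in> carrier F" using u v by auto
      have ca: "u a \<in> carrier R" using module_hom_closed[OF \<pi> cu(1)] by simp
      interpret RM: module R "ring_module R" by (rule RM)
      have "(u \<ominus>\<^bsub>F\<^esub> v) a = \<zero>\<^bsub>R\<^esub>"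
        using module_hom_minus[OF F RM \<pi> cu] v(3) ca RM.M.minus_eq_zero_iff[of "u a" "v a"] by simp
      moreover have "u \<ominus>\<^bsub>F\<^esub> v \<in> K"
        using F.submoduleE(3,5)[OF insert.prems(2)] u v by (simp add: F.M.minus_eq)
      ultimately have "u \<ominus>\<^bsub>F\<^esub> v \<in> V" using T(3) V cu by auto
      then have "(u \<ominus>\<^bsub>F\<^esub> v) \<oplus>\<^bsub>F\<^esub> v \<in> V" using F.submoduleE(5)[OF V(1)] v by blast
      then show "u \<in> V" using cu by (simp add: F.M.minus_eq F.M.a_assoc F.M.l_neg)
    qed
    then show ?case using T L by (intro exI[of _ "T \<union> L"]) auto
  qed
  show ?thesis by (rule step[OF assms(4) subset_refl assms(5)]) auto
qed

lemma (in abelian_monoid) finsum_swap: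
  assumes "finite A" "finite B" "\<And>i j. i \<in> A \<Longrightarrow> j \<in> B \<Longrightarrow> f i j \<in> carrier G"
  shows "(\<Oplus>i\<in>A. \<Oplus>j\<in>B. f i j) = (\<Oplus>j\<in>B. \<Oplus>i\<in>A. f i j)"
  using assms(1,3)
proof (induction A rule: finite_induct)
  case empty
  then show ?case by (simp add: finsum_zero)
next
  case (insert a A)
  have "(\<Oplus>i\<in>insert a A. \<Oplus>j\<in>B. f i j) = (\<Oplus>j\<in>B. f a j) \<oplus> (\<Oplus>j\<in>B. \<Oplus>i\<in>A. f i j)"
    using insert.hyps insert.prems insert.IH by (subst finsum_insert) auto
  also have "\<dots> = (\<Oplus>j\<in>B. f a j \<oplus> (\<Oplus>i\<in>A. f i j))"
    using insert.prems by (intro finsum_addf[symmetric]) auto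
  also have "\<dots> = (\<Oplus>j\<in>B. \<Oplus>i\<in>insert a A. f i j)"
    using insert.hyps insert.prems by (intro finsum_cong') (auto simp: Pi_iff)
  finally show ?case .
qed

section \<open>Modules killed by the annihilator of an ideal\<close>

text \<open>The setting of the theorem, with the hull replaced by an injective module that contains a
  nonzero element \<open>s\<close> killed by \<open>\<mm>\<close>.\<close>

locale local_ring_ideal_cogenerator =
  fixes R :: "('a, 'b) ring_scheme" and \<mm> I :: "'a set" and E :: "('a, 'm) module" and s :: 'm
  assumes loc: "local_ring R \<mm>" and noeth: "noetherian_ring R" and ideal_I: "ideal I R"
    and inj: "injective_module R E"
    and s: "s \<in> carrier E" "s \<noteq> \<zero>\<^bsub>E\<^esub>" "\<And>r. r \<in> \<mm> \<Longrightarrow> r \<odot>\<^bsub>E\<^esub> s = \<zero>\<^bsub>E\<^esub>"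
    and infinite_universe: "infinite (UNIV :: 'm set)" and small_ring: "carrier R \<lesssim> (UNIV :: 'm set)"
begin

abbreviation "RR \<equiv> ring_module R"
abbreviation "II \<equiv> ideal_module R I"
abbreviation "\<aa> \<equiv> annihilator R II"
abbreviation "Rq \<equiv> quotient_module RR \<aa>"
abbreviation "I_dual \<equiv> hom_module R II E"
abbreviation cls :: "'a \<Rightarrow> 'a set" where "cls r \<equiv> \<aa> +>\<^bsub>RR\<^esub> r"

lemma cring: "cring R" using loc by (simp add: local_ring_def)
lemma \<mm>_maximal: "maximalideal \<mm> R" using loc by (simp add: local_ring_def)

sublocale R: cring R by (rule cring)
sublocale \<mm>: maximalideal \<mm> R by (rule \<mm>_maximal)
sublocale I: ideal I R by (rule ideal_I)

lemma module_RR: "module R RR" by (rule module_ring_module[OF cring])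
lemma module_II: "module R II" by (rule module_ideal_module[OF cring ideal_I])
lemma module_E: "module R E" using inj by (simp add: injective_module_def)
lemma module_dual: "module R I_dual" by (rule module_hom_module[OF module_II module_E])

lemma one_notin_\<mm>: "\<one>\<^bsub>R\<^esub> \<notin> \<mm>"
  using \<mm>.I_notcarr \<mm>.one_imp_carrier by blast

lemma annihilator_iff: "c \<in> \<aa> \<longleftrightarrow> c \<in> carrier R \<and> (\<forall>i\<in>I. c \<otimes>\<^bsub>R\<^esub> i = \<zero>\<^bsub>R\<^esub>)"
  by (simp add: annihilator_def)

lemma annihilator_ideal: "ideal \<aa> R"
proof -
  have "subgroup \<aa> (add_monoid R)"
  proof (rule R.add.subgroupI)
    have "\<zero>\<^bsub>R\<^esub> \<in> \<aa>" using I.a_subset by (auto simp: annihilator_iff)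
    then show "\<aa> \<noteq> {}" by blast
  qed (auto simp: annihilator_iff a_inv_def[symmetric] R.l_distr R.l_minus)
  moreover have l: "x \<otimes>\<^bsub>R\<^esub> c \<in> \<aa>" if "c \<in> \<aa>" "x \<in> carrier R" for c x
    using that I.a_subset by (auto simp: annihilator_iff R.m_assoc subset_iff)
  moreover have "c \<otimes>\<^bsub>R\<^esub> x \<in> \<aa>" if "c \<in> \<aa>" "x \<in> carrier R" for c x
  proof -
    have "c \<in> carrier R" using that(1) by (simp add: annihilator_iff)
    then have "c \<otimes>\<^bsub>R\<^esub> x = x \<otimes>\<^bsub>R\<^esub> c" using that(2) by (rule R.m_comm)
    then show ?thesis using l[OF that] by metis
  qed
  ultimately show ?thesis by (intro idealI[OF R.ring_axioms]) simp_all
qed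

lemma \<aa>_sub: "submodule \<aa> R RR" by (rule ideal_submodule[OF cring annihilator_ideal])
lemma module_Rq: "module R Rq" by (rule module_quotient[OF module_RR \<aa>_sub])
lemma cls_epi: "cls \<in> module_epi R RR Rq" by (rule quotient_module_proj[OF module_RR \<aa>_sub])
lemma cls_hom: "cls \<in> module_hom R RR Rq" using cls_epi by (simp add: module_epi_def)

lemma cls_smult: "c \<in> carrier R \<Longrightarrow> r \<in> carrier R \<Longrightarrow> c \<odot>\<^bsub>Rq\<^esub> cls r = cls (c \<otimes>\<^bsub>R\<^esub> r)"
  using module_hom_smult[OF cls_hom] by simp

lemma cls_zero: "r \<in> carrier R \<Longrightarrow> cls r = \<zero>\<^bsub>Rq\<^esub> \<longleftrightarrow> r \<in> \<aa>"
  using quotient_module_proj_eq_zero[OF module_RR \<aa>_sub] by simp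

lemma carrier_Rq: "carrier Rq = cls ` carrier R"
  using cls_epi by (simp add: module_epi_def)

lemma carrier_Rq_small: "carrier Rq \<lesssim> (UNIV :: 'm set)"
  unfolding carrier_Rq using image_lepoll small_ring by (rule lepoll_trans)

lemma annihilated_hom:
  assumes "module R M" "x \<in> carrier M" "\<And>c. c \<in> \<aa> \<Longrightarrow> c \<odot>\<^bsub>M\<^esub> x = \<zero>\<^bsub>M\<^esub>"
  shows "\<exists>g\<in>module_hom R Rq M. \<forall>r\<in>carrier R. g (cls r) = r \<odot>\<^bsub>M\<^esub> x"
  by (rule quotient_ring_hom[OF assms(1) annihilator_ideal assms(2,3)])

lemma unit: "r \<in> carrier R \<Longrightarrow> r \<notin> \<mm> \<Longrightarrow> \<exists>r'\<in>carrier R. r' \<otimes>\<^bsub>R\<^esub> r = \<one>\<^bsub>R\<^esub>"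
  by (rule local_ring_unit[OF loc noeth])

text \<open>The annihilator of \<open>x \<noteq> 0\<close> is contained in \<open>\<mm>\<close>, which kills \<open>s\<close>. So \<open>r x \<mapsto> r s\<close> is well
  defined on \<open>R x\<close>, and it extends to \<open>B\<close> by injectivity.\<close>

lemma E_cogenerates:
  assumes "module R B" "carrier B \<lesssim> (UNIV :: 'm set)" "x \<in> carrier B" "x \<noteq> \<zero>\<^bsub>B\<^esub>"
  shows "\<exists>f\<in>module_hom R B E. f x \<noteq> \<zero>\<^bsub>E\<^esub>"
proof -
  interpret B: module R B by fact
  let ?p = "\<lambda>r. r \<odot>\<^bsub>B\<^esub> x"
  let ?A = "?p ` carrier R"
  note p = ring_smult_hom[OF assms(1,3)]
  have A: "submodule ?A R B"
    using module_hom_image_submodule[OF module_RR assms(1) p module.carrier_is_submodule[OF module_RR]] by simp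
  have pA: "?p \<in> module_epi R RR (B\<lparr>carrier := ?A\<rparr>)"
    using p by (auto simp: module_epi_def module_hom_def)
  have "r \<odot>\<^bsub>E\<^esub> s = \<zero>\<^bsub>E\<^esub>" if r: "r \<in> carrier R" "r \<odot>\<^bsub>B\<^esub> x = \<zero>\<^bsub>B\<^esub>" for r
  proof (rule s(3), rule ccontr)
    assume "r \<notin> \<mm>"
    then obtain r' where r': "r' \<in> carrier R" "r' \<otimes>\<^bsub>R\<^esub> r = \<one>\<^bsub>R\<^esub>" using unit r(1) by blast
    then have "x = (r' \<otimes>\<^bsub>R\<^esub> r) \<odot>\<^bsub>B\<^esub> x" using assms(3) by simp
    also have "\<dots> = \<zero>\<^bsub>B\<^esub>" using r r'(1) assms(3) B.smult_assoc1 by simp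
    finally show False using assms(4) by simp
  qed
  then obtain g where g: "g \<in> module_hom R (B\<lparr>carrier := ?A\<rparr>) E"
    "\<And>r. r \<in> carrier R \<Longrightarrow> g (r \<odot>\<^bsub>B\<^esub> x) = r \<odot>\<^bsub>E\<^esub> s"
    using module_hom_factor_epi[OF module_RR submodule_module[OF assms(1) A] module_E pA ring_smult_hom[OF module_E s(1)]]
    by auto
  obtain f where f: "f \<in> module_hom R B E" "\<forall>y\<in>?A. f y = g y"
    using injective_extension[OF inj assms(1,2) A g(1)] by blast
  have "f x = s"
    using f(2) g(2)[of "\<one>\<^bsub>R\<^esub>"] assms(3) module.smult_one[OF module_E s(1)]
    by (metis B.smult_one R.one_closed imageI)
  then show ?thesis using f(1) s(2) by blast
qed

lemma cogenerated_iff: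
  assumes "module R M"
  shows "cogenerated_by R I_dual M \<longleftrightarrow>
    (\<forall>x\<in>carrier M. x \<noteq> \<zero>\<^bsub>M\<^esub> \<longrightarrow>
      (\<exists>\<beta>. (\<forall>i\<in>I. (\<lambda>x. \<beta> x i) \<in> module_hom R M E) \<and>
           (\<forall>x\<in>carrier M. \<beta> x \<in> module_hom R II E) \<and> (\<exists>i\<in>I. \<beta> x i \<noteq> \<zero>\<^bsub>E\<^esub>)))"
  using cogenerated_by_hom_module_iff[OF module_II module_E assms] by simp

lemma generated_annihilated:
  assumes "module R M" "generated_by R II M" "c \<in> \<aa>" "x \<in> carrier M"
  shows "c \<odot>\<^bsub>M\<^esub> x = \<zero>\<^bsub>M\<^esub>"
proof -
  have c: "c \<in> carrier R" using assms(3) by (simp add: annihilator_iff)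
  have "{y \<in> carrier M. c \<odot>\<^bsub>M\<^esub> y \<in> {\<zero>\<^bsub>M\<^esub>}} = carrier M"
  proof (rule generated_byD[OF module_II assms(1,2)])
    show "submodule {y \<in> carrier M. c \<odot>\<^bsub>M\<^esub> y \<in> {\<zero>\<^bsub>M\<^esub>}} R M"
      by (rule module_hom_preimage_submodule[OF assms(1,1) smult_hom[OF assms(1) c]
            zero_submodule[OF assms(1)]])
    fix h assume h: "h \<in> module_hom R II M"
    have "c \<odot>\<^bsub>M\<^esub> h i = \<zero>\<^bsub>M\<^esub>" if "i \<in> I" for i
      using module_hom_smult[OF h c, of i] module_hom_zero[OF module_II assms(1) h] that assms(3)
      by (simp add: annihilator_iff)
    then show "h ` carrier II \<subseteq> {y \<in> carrier M. c \<odot>\<^bsub>M\<^esub> y \<in> {\<zero>\<^bsub>M\<^esub>}}"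
      using module_hom_closed[OF h] by auto
  qed
  then show ?thesis using assms(4) by auto
qed

text \<open>If \<open>c\<close> kills \<open>I\<close>, then \<open>\<beta>(c x, i) = \<beta>(x, c i) = 0\<close> for every bilinear \<open>\<beta>\<close>.\<close>

lemma cogenerated_annihilated:
  assumes "module R M" "cogenerated_by R I_dual M" "c \<in> \<aa>" "x \<in> carrier M"
  shows "c \<odot>\<^bsub>M\<^esub> x = \<zero>\<^bsub>M\<^esub>"
proof (rule ccontr)
  interpret M: module R M by fact
  have c: "c \<in> carrier R" using assms(3) by (simp add: annihilator_iff)
  assume "c \<odot>\<^bsub>M\<^esub> x \<noteq> \<zero>\<^bsub>M\<^esub>"
  then obtain \<beta> i where \<beta>: "\<And>i. i \<in> I \<Longrightarrow> (\<lambda>x. \<beta> x i) \<in> module_hom R M E"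
    "\<And>x. x \<in> carrier M \<Longrightarrow> \<beta> x \<in> module_hom R II E" and i: "i \<in> I" "\<beta> (c \<odot>\<^bsub>M\<^esub> x) i \<noteq> \<zero>\<^bsub>E\<^esub>"
    using assms(2) M.smult_closed[OF c assms(4)] unfolding cogenerated_iff[OF assms(1)] by blast
  have "\<beta> (c \<odot>\<^bsub>M\<^esub> x) i = c \<odot>\<^bsub>E\<^esub> \<beta> x i" using module_hom_smult[OF \<beta>(1)[OF i(1)] c assms(4)] .
  also have "\<dots> = \<beta> x (c \<otimes>\<^bsub>R\<^esub> i)" using module_hom_smult[OF \<beta>(2)[OF assms(4)] c, of i] i(1) by simp
  also have "c \<otimes>\<^bsub>R\<^esub> i = \<zero>\<^bsub>R\<^esub>" using assms(3) i(1) by (simp add: annihilator_iff)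
  also have "\<beta> x \<zero>\<^bsub>R\<^esub> = \<zero>\<^bsub>E\<^esub>" using module_hom_zero[OF module_II module_E \<beta>(2)[OF assms(4)]] by simp
  finally show False using i(2) by simp
qed

lemma epi_imp_generated:
  fixes M :: "('a, 'm) module"
  assumes "\<pi> \<in> module_epi R II Rq" "M \<in> annihilated_class R \<aa>"
  shows "generated_by R II M"
proof (rule generated_by_homsI[OF module_II])
  show M: "module R M" using assms(2) by (simp add: annihilated_class_def)
  fix x assume x: "x \<in> carrier M"
  have \<pi>: "\<pi> \<in> module_hom R II Rq" "\<pi> ` I = carrier Rq" using assms(1) by (auto simp: module_epi_def)
  obtain g where g: "g \<in> module_hom R Rq M" "\<forall>r\<in>carrier R. g (cls r) = r \<odot>\<^bsub>M\<^esub> x"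
    using annihilated_hom[OF M x] assms(2) x by (auto simp: annihilated_class_def)
  have "cls \<one>\<^bsub>R\<^esub> \<in> \<pi> ` I" unfolding \<pi>(2) carrier_Rq by simp
  then obtain i where "i \<in> I" "\<pi> i = cls \<one>\<^bsub>R\<^esub>" by auto
  then have "x \<in> (\<lambda>i. g (\<pi> i)) ` carrier II"
    using g(2) module.smult_one[OF M x] by (intro image_eqI[of _ _ i]) simp_all
  then show "\<exists>h\<in>module_hom R II M. x \<in> h ` carrier II"
    by (intro bexI[of _ "\<lambda>i. g (\<pi> i)"] module_hom_comp[OF \<pi>(1) g(1)])
qed

lemma epi_imp_cogenerated:
  fixes M :: "('a, 'm) module"
  assumes "\<pi> \<in> module_epi R II Rq" "M \<in> annihilated_class R \<aa>"
  shows "cogenerated_by R I_dual M"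
proof -
  have M: "module R M" using assms(2) by (simp add: annihilated_class_def)
  interpret M: module R M by fact
  have \<pi>: "\<pi> \<in> module_hom R II Rq" "\<pi> ` I = carrier Rq" using assms(1) by (auto simp: module_epi_def)
  have "\<exists>g\<in>module_hom R Rq M. \<forall>r\<in>carrier R. g (cls r) = r \<odot>\<^bsub>M\<^esub> y" if "y \<in> carrier M" for y
    using annihilated_hom[OF M that] assms(2) that by (auto simp: annihilated_class_def)
  then obtain g where g: "\<And>y. y \<in> carrier M \<Longrightarrow> g y \<in> module_hom R Rq M"
    "\<And>y r. y \<in> carrier M \<Longrightarrow> r \<in> carrier R \<Longrightarrow> g y (cls r) = r \<odot>\<^bsub>M\<^esub> y" by metis
  show ?thesis
    unfolding cogenerated_iff[OF M]
  proof (intro ballI impI)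
    fix x assume x: "x \<in> carrier M" "x \<noteq> \<zero>\<^bsub>M\<^esub>"
    obtain f where f: "f \<in> module_hom R M E" "f x \<noteq> \<zero>\<^bsub>E\<^esub>"
      using E_cogenerates[OF M subset_imp_lepoll x] by auto
    let ?\<beta> = "\<lambda>y i. f (g y (\<pi> i))"
    have "(\<lambda>y. ?\<beta> y i) \<in> module_hom R M E" if i: "i \<in> I" for i
    proof -
      obtain r where r: "r \<in> carrier R" "\<pi> i = cls r" using \<pi>(2) i carrier_Rq by blast
      have "(\<lambda>y. f (r \<odot>\<^bsub>M\<^esub> y)) \<in> module_hom R M E"
        by (rule module_hom_comp[OF smult_hom[OF M r(1)] f(1)])
      then show ?thesis using r g(2) by (auto simp: module_hom_def)
    qed
    moreover have "?\<beta> y \<in> module_hom R II E" if "y \<in> carrier M" for y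
      by (rule module_hom_comp[OF module_hom_comp[OF \<pi>(1) g(1)[OF that]] f(1)])
    moreover have "\<exists>i\<in>I. ?\<beta> x i \<noteq> \<zero>\<^bsub>E\<^esub>"
    proof -
      have "cls \<one>\<^bsub>R\<^esub> \<in> \<pi> ` I" unfolding \<pi>(2) carrier_Rq by simp
      then obtain i where "i \<in> I" "\<pi> i = cls \<one>\<^bsub>R\<^esub>" by auto
      then show ?thesis using g(2)[OF x(1)] x(1) f(2) by (intro bexI[of _ i]) simp_all
    qed
    ultimately show "\<exists>\<beta>. (\<forall>i\<in>I. (\<lambda>x. \<beta> x i) \<in> module_hom R M E) \<and>
        (\<forall>x\<in>carrier M. \<beta> x \<in> module_hom R II E) \<and> (\<exists>i\<in>I. \<beta> x i \<noteq> \<zero>\<^bsub>E\<^esub>)"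
      by (intro exI[of _ ?\<beta>]) simp
  qed
qed

lemma annihilated_closed_under_submodules:
  "closed_under_submodules R (annihilated_class R \<aa> :: ('a, 'm) module set)"
  unfolding closed_under_submodules_def
proof (intro ballI allI impI)
  fix M :: "('a, 'm) module" and U assume M: "M \<in> annihilated_class R \<aa>" and U: "submodule U R M"
  then have MR: "module R M" by (simp add: annihilated_class_def)
  then have "U \<subseteq> carrier M" using module.submoduleE(1)[OF MR U] by simp
  then show "M\<lparr>carrier := U\<rparr> \<in> annihilated_class R \<aa>"
    using M submodule_module[OF MR U] by (auto simp: annihilated_class_def)
qed

lemma annihilated_closed_under_factor_modules:
  "closed_under_factor_modules R (annihilated_class R \<aa> :: ('a, 'm) module set)"
  unfolding closed_under_factor_modules_def
proof (intro ballI allI impI)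
  fix M Q :: "('a, 'm) module" and U
  assume M: "M \<in> annihilated_class R \<aa>" and U: "submodule U R M" and Q: "module R Q"
    and "module_iso R (quotient_module M U) Q \<noteq> {}"
  then obtain f where f: "f \<in> module_iso R (quotient_module M U) Q" by blast
  have MR: "module R M" using M by (simp add: annihilated_class_def)
  note p = quotient_module_proj[OF MR U]
  let ?h = "\<lambda>x. f (U +>\<^bsub>M\<^esub> x)"
  have h: "?h \<in> module_hom R M Q"
    using module_hom_comp[of "a_r_coset M U" R M "quotient_module M U" f Q] p module_iso_hom[OF f]
    by (simp add: module_epi_def)
  have "carrier Q = f ` (a_r_coset M U ` carrier M)"
    using f p by (simp add: module_iso_def module_epi_def bij_betw_def)
  then have "\<exists>x\<in>carrier M. y = ?h x" if "y \<in> carrier Q" for y using that by auto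
  then have "c \<odot>\<^bsub>Q\<^esub> y = \<zero>\<^bsub>Q\<^esub>" if c: "c \<in> \<aa>" and "y \<in> carrier Q" for c y
    using that M module_hom_smult[OF h, of c, symmetric] module_hom_zero[OF MR Q h]
    by (fastforce simp: annihilated_class_def annihilator_iff)
  then show "Q \<in> annihilated_class R \<aa>" using Q by (simp add: annihilated_class_def)
qed

text \<open>A homomorphism to \<open>R/Ann(I)\<close> that takes the class of a unit as a value is onto.\<close>

lemma no_epi_imp_hom_values:
  assumes "module_epi R II Rq = {}" "h \<in> module_hom R II Rq" "i \<in> I" "r \<in> carrier R" "h i = cls r"
  shows "r \<in> \<mm>"
proof (rule ccontr)
  assume "r \<notin> \<mm>"
  then obtain r' where r': "r' \<in> carrier R" "r' \<otimes>\<^bsub>R\<^esub> r = \<one>\<^bsub>R\<^esub>" using unit assms(4) by blast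
  have "carrier Rq \<subseteq> h ` I"
  proof
    fix c assume "c \<in> carrier Rq"
    then obtain t where t: "t \<in> carrier R" "c = cls t" by (auto simp: carrier_Rq)
    have "h ((t \<otimes>\<^bsub>R\<^esub> r') \<otimes>\<^bsub>R\<^esub> i) = (t \<otimes>\<^bsub>R\<^esub> r') \<odot>\<^bsub>Rq\<^esub> cls r"
      using module_hom_smult[OF assms(2), of "t \<otimes>\<^bsub>R\<^esub> r'" i] assms(3,5) t r' by simp
    also have "\<dots> = c" using t r' assms(4) by (simp add: cls_smult R.m_assoc)
    finally show "c \<in> h ` I" using t r' assms(3) I.I_l_closed by (intro image_eqI[of _ _ "(t \<otimes>\<^bsub>R\<^esub> r') \<otimes>\<^bsub>R\<^esub> i"]) auto
  qed
  then have "h \<in> module_epi R II Rq"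
    using assms(2) module_hom_closed[OF assms(2)] by (auto simp: module_epi_def)
  then show False using assms(1) by simp
qed

text \<open>The elements of \<open>Ann(I)\<close> represent the values of the zero homomorphism.\<close>

lemma no_epi_imp_annihilator_le:
  assumes "module_epi R II Rq = {}" shows "\<aa> \<subseteq> \<mm>"
proof
  fix c assume c: "c \<in> \<aa>"
  interpret Rq: module R Rq by (rule module_Rq)
  have "(\<lambda>i. \<zero>\<^bsub>Rq\<^esub>) \<in> module_hom R II Rq" by (rule module_homI) auto
  then show "c \<in> \<mm>"
    using no_epi_imp_hom_values[OF assms _ I.zero_closed, of _ c] c cls_zero[of c]
    by (auto simp: annihilator_iff)
qed

lemma finite_generators:
  obtains X where "finite X" "X \<subseteq> I" "I = Idl\<^bsub>R\<^esub> X"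
proof -
  obtain X where "X \<subseteq> carrier R" "finite X" "I = Idl\<^bsub>R\<^esub> X"
    using noetherian_ring.finetely_gen[OF noeth ideal_I] by blast
  then show ?thesis using that R.genideal_self by blast
qed

lemma Idl_subset_preimage:
  assumes "X \<subseteq> carrier R" "module R M" "f \<in> module_hom R RR M" "submodule V R M"
    and "\<And>x. x \<in> X \<Longrightarrow> f x \<in> V" and "i \<in> Idl\<^bsub>R\<^esub> X"
  shows "f i \<in> V"
proof -
  have "ideal {x \<in> carrier RR. f x \<in> V} R"
    by (rule submodule_ring_module_ideal[OF cring module_hom_preimage_submodule[OF module_RR assms(2-4)]])
  then show ?thesis using R.genideal_minimal[of _ X] assms by fastforce
qed

section \<open>Closure under submodules implies an epimorphism onto the cyclic module\<close>

text \<open>In the proof, \<open>d\<close> is the image of the generating family \<open>(x)\<^sub>x\<close> in a copy \<open>M\<close> of \<open>I\<^sup>X\<close>. Its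
  annihilator is \<open>Ann(I)\<close>, so \<open>R d\<close> is isomorphic to \<open>R/Ann(I)\<close>. If no homomorphism from \<open>I\<close> is
  onto, the trace of \<open>I\<close> in \<open>R d\<close> lies in \<open>\<mm> d\<close>. So \<open>d \<in> \<mm> d\<close>, and Nakayama's argument applies.\<close>

lemma closed_under_submodules_imp_epi:
  assumes "closed_under_submodules R (generated_class R II :: ('a, 'm) module set)"
  shows "module_epi R II Rq \<noteq> {}"
proof
  assume no_epi: "module_epi R II Rq = {}"
  obtain X where X: "finite X" "X \<subseteq> I" "I = Idl\<^bsub>R\<^esub> X" by (rule finite_generators)
  have XR: "X \<subseteq> carrier R" using X(2) I.a_subset by auto
  let ?P = "power_module X II"
  have P: "module R ?P" by (rule module_power[OF module_II])
  have "I \<lesssim> (UNIV :: 'm set)"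
    using lepoll_trans[OF subset_imp_lepoll[OF I.a_subset] small_ring] .
  then have "carrier ?P \<lesssim> (UNIV :: 'm set)"
    using finite_PiE_lepoll[OF X(1) infinite_universe] by (simp add: power_module_simps)
  then obtain M :: "('a, 'm) module" and \<theta> where M: "module R M" and \<theta>: "\<theta> \<in> module_iso R ?P M"
    using module_copy_exists[OF P] by blast
  interpret M: module R M by (rule M)
  have "generated_by R II M"
    by (rule generated_byI[OF _ module_II M, of \<theta> X])
      (use module_iso_epi[OF \<theta>] in \<open>simp add: copower_module_finite[OF X(1)]\<close>)
  then have MP: "M \<in> generated_class R II" using M by (simp add: generated_class_def)
  let ?\<iota> = "\<lambda>x\<in>X. x"
  have \<iota>: "?\<iota> \<in> carrier ?P" using X(2) by (auto simp: power_module_simps)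
  define d where "d = \<theta> ?\<iota>"
  have d: "d \<in> carrier M" unfolding d_def by (rule module_hom_closed[OF module_iso_hom[OF \<theta>] \<iota>])
  let ?p = "\<lambda>r. r \<odot>\<^bsub>M\<^esub> d"
  note p = ring_smult_hom[OF M d]
  have ker: "r \<in> \<aa>" if r: "r \<in> carrier R" "r \<odot>\<^bsub>M\<^esub> d = \<zero>\<^bsub>M\<^esub>" for r
  proof -
    interpret P: module R ?P by (rule P)
    have "\<theta> (r \<odot>\<^bsub>?P\<^esub> ?\<iota>) = \<theta> \<zero>\<^bsub>?P\<^esub>"
      using module_hom_smult[OF module_iso_hom[OF \<theta>] r(1) \<iota>] r(2)
        module_hom_zero[OF P M module_iso_hom[OF \<theta>]] by (simp add: d_def)
    moreover have "inj_on \<theta> (carrier ?P)" using \<theta> by (simp add: module_iso_def bij_betw_def)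
    ultimately have "r \<odot>\<^bsub>?P\<^esub> ?\<iota> = \<zero>\<^bsub>?P\<^esub>"
      using P.smult_closed[OF r(1) \<iota>] P.M.zero_closed by (auto dest: inj_onD)
    then have rX: "r \<otimes>\<^bsub>R\<^esub> x = \<zero>\<^bsub>R\<^esub>" if "x \<in> X" for x
      using that by (simp add: power_module_simps restrict_eq_iff)
    have "r \<otimes>\<^bsub>R\<^esub> i = \<zero>\<^bsub>R\<^esub>" if "i \<in> I" for i
      using Idl_subset_preimage[OF XR module_RR smult_hom[OF module_RR r(1)] zero_submodule[OF module_RR], of i] rX that X(3)
      by simp
    then show ?thesis using r(1) by (simp add: annihilator_iff)
  qed
  let ?U = "?p ` carrier R"
  have U: "submodule ?U R M"
    using module_hom_image_submodule[OF module_RR M p module.carrier_is_submodule[OF module_RR]] by simp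
  define N where "N = M\<lparr>carrier := ?U\<rparr>"
  have N: "module R N" unfolding N_def by (rule submodule_module[OF M U])
  have "N \<in> generated_class R II"
    using assms MP U unfolding closed_under_submodules_def N_def by blast
  then have genN: "generated_by R II N" by (simp add: generated_class_def)
  have pN: "?p \<in> module_epi R RR N"
    using p by (auto simp: N_def module_epi_def module_hom_def)
  then have pNh: "?p \<in> module_hom R RR N" by (simp add: module_epi_def)
  have "\<exists>g\<in>module_hom R N Rq. \<forall>r\<in>carrier RR. g (r \<odot>\<^bsub>M\<^esub> d) = cls r"
    by (rule module_hom_factor_epi[OF module_RR N module_Rq pN cls_hom])
      (use ker cls_zero in \<open>simp add: N_def\<close>)
  then obtain g where g: "g \<in> module_hom R N Rq" "\<And>r. r \<in> carrier R \<Longrightarrow> g (r \<odot>\<^bsub>M\<^esub> d) = cls r"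
    by auto
  have "?p ` \<mm> = carrier N"
  proof (rule generated_byD[OF module_II N genN])
    show "submodule (?p ` \<mm>) R N"
      by (rule module_hom_image_submodule[OF module_RR N pNh ideal_submodule[OF cring \<mm>.is_ideal]])
    fix h assume h: "h \<in> module_hom R II N"
    show "h ` carrier II \<subseteq> ?p ` \<mm>"
    proof
      fix y assume "y \<in> h ` carrier II"
      then obtain i where i: "i \<in> I" "y = h i" by auto
      then have "y \<in> ?U" using module_hom_closed[OF h] by (auto simp: N_def)
      then obtain r where r: "r \<in> carrier R" "y = r \<odot>\<^bsub>M\<^esub> d" by auto
      have "r \<in> \<mm>"
        by (rule no_epi_imp_hom_values[OF no_epi module_hom_comp[OF h g(1)] i(1) r(1)])
          (use i(2) r g(2) in metis)
      then show "y \<in> ?p ` \<mm>" using r(2) by blast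
    qed
  qed
  moreover have "\<one>\<^bsub>R\<^esub> \<odot>\<^bsub>M\<^esub> d \<in> carrier N" by (auto simp: N_def)
  ultimately obtain r where r: "r \<in> \<mm>" "\<one>\<^bsub>R\<^esub> \<odot>\<^bsub>M\<^esub> d = r \<odot>\<^bsub>M\<^esub> d" by auto
  have rR: "r \<in> carrier R" using r(1) \<mm>.a_subset by auto
  have "(\<one>\<^bsub>R\<^esub> \<ominus>\<^bsub>R\<^esub> r) \<odot>\<^bsub>M\<^esub> d = \<zero>\<^bsub>M\<^esub>"
    using r(2) rR d by (simp add: R.minus_eq M.smult_l_distr M.smult_l_minus M.M.r_neg)
  then have "\<one>\<^bsub>R\<^esub> \<ominus>\<^bsub>R\<^esub> r \<in> \<mm>"
    using ker rR no_epi_imp_annihilator_le[OF no_epi] by auto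
  then have "(\<one>\<^bsub>R\<^esub> \<ominus>\<^bsub>R\<^esub> r) \<oplus>\<^bsub>R\<^esub> r \<in> \<mm>" using r(1) by (rule \<mm>.a_closed)
  then show False using one_notin_\<mm> rR by (simp add: R.minus_eq R.a_assoc R.l_neg)
qed

section \<open>Closure under factor modules implies an epimorphism onto the cyclic module\<close>

text \<open>If \<open>r\<close> is not in \<open>Ann(I)\<close>, then \<open>r i \<noteq> 0\<close> for some \<open>i \<in> I\<close>, and some \<open>f : R \<rightarrow> E\<close> does not
  vanish on \<open>r i\<close>. The bilinear map \<open>(t + Ann(I), i) \<mapsto> f(t i)\<close> then detects \<open>r\<close>.\<close>

lemma Rq_cogenerated: "cogenerated_by R I_dual Rq"
  unfolding cogenerated_iff[OF module_Rq]
proof (intro ballI impI)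
  fix c assume c: "c \<in> carrier Rq" "c \<noteq> \<zero>\<^bsub>Rq\<^esub>"
  obtain r where r: "r \<in> carrier R" "c = cls r" using c(1) by (auto simp: carrier_Rq)
  then have "r \<notin> \<aa>" using c(2) cls_zero by simp
  then obtain i where i: "i \<in> I" "r \<otimes>\<^bsub>R\<^esub> i \<noteq> \<zero>\<^bsub>R\<^esub>" using r(1) by (auto simp: annihilator_iff)
  obtain f where f: "f \<in> module_hom R RR E" "f (r \<otimes>\<^bsub>R\<^esub> i) \<noteq> \<zero>\<^bsub>E\<^esub>"
    using E_cogenerates[OF module_RR, of "r \<otimes>\<^bsub>R\<^esub> i"] small_ring i r(1) I.a_subset by auto
  have "\<exists>g\<in>module_hom R Rq RR. \<forall>r\<in>carrier R. g (cls r) = r \<otimes>\<^bsub>R\<^esub> i" if "i \<in> I" for i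
    using annihilated_hom[OF module_RR, of i] that I.a_subset by (auto simp: annihilator_iff)
  then obtain g where g: "\<And>i. i \<in> I \<Longrightarrow> g i \<in> module_hom R Rq RR"
    "\<And>i r. i \<in> I \<Longrightarrow> r \<in> carrier R \<Longrightarrow> g i (cls r) = r \<otimes>\<^bsub>R\<^esub> i" by metis
  let ?\<beta> = "\<lambda>c i. f (g i c)"
  have "(\<lambda>c. ?\<beta> c i) \<in> module_hom R Rq E" if "i \<in> I" for i
    by (rule module_hom_comp[OF g(1)[OF that] f(1)])
  moreover have "?\<beta> c \<in> module_hom R II E" if c: "c \<in> carrier Rq" for c
  proof -
    obtain t where t: "t \<in> carrier R" "c = cls t" using c by (auto simp: carrier_Rq)
    have "(\<lambda>i. f (t \<otimes>\<^bsub>R\<^esub> i)) \<in> module_hom R RR E"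
      using module_hom_comp[OF smult_hom[OF module_RR t(1)] f(1)] by simp
    then have "(\<lambda>i. f (t \<otimes>\<^bsub>R\<^esub> i)) \<in> module_hom R II E"
      using I.a_subset by (auto simp: module_hom_def subset_iff)
    then show ?thesis using t g(2) I.I_l_closed I.a_closed by (auto simp: module_hom_def)
  qed
  moreover have "\<exists>i\<in>I. ?\<beta> c i \<noteq> \<zero>\<^bsub>E\<^esub>" using i f(2) g(2) r by (intro bexI[of _ i]) simp_all
  ultimately show "\<exists>\<beta>. (\<forall>i\<in>I. (\<lambda>x. \<beta> x i) \<in> module_hom R Rq E) \<and>
      (\<forall>x\<in>carrier Rq. \<beta> x \<in> module_hom R II E) \<and> (\<exists>i\<in>I. \<beta> c i \<noteq> \<zero>\<^bsub>E\<^esub>)"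
    by (intro exI[of _ ?\<beta>]) simp
qed

definition dot :: "'a set \<Rightarrow> ('a \<Rightarrow> 'a) \<Rightarrow> ('a \<Rightarrow> 'a) \<Rightarrow> 'a" where
  "dot X t y = (\<Oplus>\<^bsub>R\<^esub>x\<in>X. t x \<otimes>\<^bsub>R\<^esub> y x)"

lemma dot_commute:
  assumes "t \<in> X \<rightarrow>\<^sub>E carrier R" "y \<in> X \<rightarrow>\<^sub>E carrier R"
  shows "dot X t y = dot X y t"
  unfolding dot_def by (rule R.finsum_cong') (use assms in \<open>auto intro!: R.m_comm\<close>)

lemma dot_hom:
  assumes "finite X" "t \<in> X \<rightarrow>\<^sub>E carrier R"
  shows "dot X t \<in> module_hom R (power_module X RR) RR"
proof -
  have t: "t x \<in> carrier R" if "x \<in> X" for x using assms(2) that by auto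
  show ?thesis
  proof (rule module_homI)
    fix y assume "y \<in> carrier (power_module X RR)"
    then have y: "y x \<in> carrier R" if "x \<in> X" for x using that by (auto simp: power_module_simps)
    show "dot X t y \<in> carrier RR" using t y by (auto simp: dot_def intro!: R.finsum_closed)
    show "dot X t (a \<odot>\<^bsub>power_module X RR\<^esub> y) = a \<odot>\<^bsub>RR\<^esub> dot X t y" if a: "a \<in> carrier R" for a
    proof -
      have "dot X t (a \<odot>\<^bsub>power_module X RR\<^esub> y) = (\<Oplus>\<^bsub>R\<^esub>x\<in>X. a \<otimes>\<^bsub>R\<^esub> (t x \<otimes>\<^bsub>R\<^esub> y x))"
        unfolding dot_def
        by (rule R.finsum_cong') (use t y a in \<open>auto simp: power_module_simps R.m_lcomm\<close>)
      also have "\<dots> = a \<otimes>\<^bsub>R\<^esub> dot X t y"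
        unfolding dot_def by (rule R.finsum_rdistr[symmetric]) (use t y a assms(1) in auto)
      finally show ?thesis by simp
    qed
    fix z assume "z \<in> carrier (power_module X RR)"
    then have z: "z x \<in> carrier R" if "x \<in> X" for x using that by (auto simp: power_module_simps)
    have "dot X t (y \<oplus>\<^bsub>power_module X RR\<^esub> z) = (\<Oplus>\<^bsub>R\<^esub>x\<in>X. t x \<otimes>\<^bsub>R\<^esub> y x \<oplus>\<^bsub>R\<^esub> t x \<otimes>\<^bsub>R\<^esub> z x)"
      unfolding dot_def
      by (rule R.finsum_cong') (use t y z in \<open>auto simp: power_module_simps R.r_distr\<close>)
    also have "\<dots> = dot X t y \<oplus>\<^bsub>R\<^esub> dot X t z"
      unfolding dot_def by (rule R.finsum_addf) (use t y z in auto)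
    finally show "dot X t (y \<oplus>\<^bsub>power_module X RR\<^esub> z) = dot X t y \<oplus>\<^bsub>RR\<^esub> dot X t z" by simp
  qed
qed

lemma dot_summand:
  assumes "finite X" "t \<in> X \<rightarrow>\<^sub>E carrier R" "x \<in> X" "r \<in> carrier R"
  shows "dot X t (summand_map X RR x r) = r \<otimes>\<^bsub>R\<^esub> t x"
proof -
  have t: "t x \<in> carrier R" if "x \<in> X" for x using assms(2) that by auto
  have "dot X t (summand_map X RR x r) = (\<Oplus>\<^bsub>R\<^esub>k\<in>X. if x = k then t k \<otimes>\<^bsub>R\<^esub> r else \<zero>\<^bsub>R\<^esub>)"
    unfolding dot_def
    by (rule R.finsum_cong') (use t assms(4) in \<open>auto simp: summand_map_def\<close>)
  also have "\<dots> = t x \<otimes>\<^bsub>R\<^esub> r"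
    by (rule R.add.finprod_singleton[OF assms(3,1)]) (use t assms(4) in auto)
  finally show ?thesis using t assms(3,4) by (simp add: R.m_comm)
qed

text \<open>With the identity as coefficient vector, the scalar product is the presentation map
  \<open>R\<^sup>X \<rightarrow> I\<close>, \<open>u \<mapsto> \<Sum>\<^sub>x u\<^sub>x x\<close>.\<close>

lemma dot_generators_epi:
  assumes "finite X" "X \<subseteq> I" "I = Idl\<^bsub>R\<^esub> X"
  shows "dot X (\<lambda>x\<in>X. x) \<in> module_epi R (power_module X RR) II"
proof -
  let ?\<iota> = "\<lambda>x\<in>X. x" and ?P = "power_module X RR"
  have P: "module R ?P" by (rule module_power[OF module_RR])
  have XR: "X \<subseteq> carrier R" using assms(2) I.a_subset by auto
  have \<iota>: "?\<iota> \<in> X \<rightarrow>\<^sub>E carrier R" using XR by auto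
  note ev = dot_hom[OF assms(1) \<iota>]
  have ev_I: "dot X ?\<iota> u \<in> I" if u: "u \<in> carrier ?P" for u
  proof -
    have uR: "u x \<in> carrier R" if "x \<in> X" for x using u that by (auto simp: power_module_simps)
    have mem: "?\<iota> x \<otimes>\<^bsub>R\<^esub> u x \<in> I" if "x \<in> X" for x
      using uR that assms(2) I.I_r_closed by auto
    have "(\<Oplus>\<^bsub>R\<^esub>x\<in>A. ?\<iota> x \<otimes>\<^bsub>R\<^esub> u x) \<in> I" if "A \<subseteq> X" for A
      using finite_subset[OF that assms(1)] that
    proof (induction A rule: finite_induct)
      case (insert a A)
      then have "(\<lambda>x. ?\<iota> x \<otimes>\<^bsub>R\<^esub> u x) \<in> A \<rightarrow> carrier R" "?\<iota> a \<otimes>\<^bsub>R\<^esub> u a \<in> carrier R"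
        using mem I.a_subset by (auto simp del: restrict_apply)
      then show ?case using insert mem by (simp del: restrict_apply add: I.a_closed)
    qed simp
    then show ?thesis by (simp add: dot_def)
  qed
  have "dot X ?\<iota> \<in> module_hom R ?P II"
    using ev ev_I by (auto simp: module_hom_def)
  moreover have "I \<subseteq> dot X ?\<iota> ` carrier ?P"
    unfolding assms(3)
  proof (rule R.genideal_minimal)
    show "ideal (dot X ?\<iota> ` carrier ?P) R"
      by (rule submodule_ring_module_ideal[OF cring
            module_hom_image_submodule[OF P module_RR ev module.carrier_is_submodule[OF P]]])
    show "X \<subseteq> dot X ?\<iota> ` carrier ?P"
    proof
      fix x assume x: "x \<in> X"
      have "summand_map X RR x \<one>\<^bsub>R\<^esub> \<in> carrier ?P"
        using summand_map_closed[OF module_RR, of "\<one>\<^bsub>R\<^esub>" X x] by (simp add: copower_module_finite[OF assms(1)])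
      moreover have "dot X ?\<iota> (summand_map X RR x \<one>\<^bsub>R\<^esub>) = x"
        using dot_summand[OF assms(1) \<iota> x R.one_closed] x XR by auto
      ultimately show "x \<in> dot X ?\<iota> ` carrier ?P" by (metis imageI)
    qed
  qed
  ultimately show ?thesis using ev_I by (auto simp: module_epi_def)
qed

lemma hom_dot_generators:
  assumes "finite X" "X \<subseteq> I" "I = Idl\<^bsub>R\<^esub> X" "module R M" "\<phi> \<in> module_hom R II M"
    and u: "u \<in> carrier (power_module X RR)"
  shows "\<phi> (dot X (\<lambda>x\<in>X. x) u) = (\<Oplus>\<^bsub>M\<^esub>x\<in>X. u x \<odot>\<^bsub>M\<^esub> \<phi> x)"
proof -
  interpret M: module R M by fact
  let ?\<iota> = "\<lambda>x\<in>X. x"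
  have XR: "X \<subseteq> carrier R" using assms(2) I.a_subset by auto
  have \<iota>: "?\<iota> \<in> X \<rightarrow>\<^sub>E carrier R" using XR by auto
  have uR: "u x \<in> carrier R" if "x \<in> X" for x using u that by (auto simp: power_module_simps)
  have ev: "dot X ?\<iota> \<in> module_hom R (copower_module X RR) II"
    using dot_generators_epi[OF assms(1-3)] by (simp add: module_epi_def copower_module_finite[OF assms(1)])
  have "\<phi> (dot X ?\<iota> u) = (\<Oplus>\<^bsub>M\<^esub>x\<in>X. \<phi> (dot X ?\<iota> (summand_map X RR x (u x))))"
    by (rule hom_copower_expand[OF module_RR assms(4) module_hom_comp[OF ev assms(5)] assms(1) subset_refl])
      (use u in \<open>auto simp: copower_module_finite[OF assms(1)]\<close>)
  also have "\<dots> = (\<Oplus>\<^bsub>M\<^esub>x\<in>X. u x \<odot>\<^bsub>M\<^esub> \<phi> x)"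
  proof (rule M.M.finsum_cong'[OF refl])
    fix x assume x: "x \<in> X"
    then show "\<phi> (dot X ?\<iota> (summand_map X RR x (u x))) = u x \<odot>\<^bsub>M\<^esub> \<phi> x"
      using dot_summand[OF assms(1) \<iota> x uR[OF x]] module_hom_smult[OF assms(5) uR[OF x], of x] assms(2)
      by auto
  next
    show "(\<lambda>x. u x \<odot>\<^bsub>M\<^esub> \<phi> x) \<in> X \<rightarrow> carrier M"
      using uR assms(2) module_hom_closed[OF assms(5)] by auto
  qed
  finally show ?thesis .
qed

text \<open>The linear-algebra core of the duality argument. Here \<open>T\<close> generates the relations among the
  generators \<open>X\<close> of \<open>I\<close>. The kernel of \<open>y \<mapsto> (\<Sum>\<^sub>x t\<^sub>x y\<^sub>x + Ann(I))\<^sub>t\<close> consists of the families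
  that describe homomorphisms \<open>I \<rightarrow> R/Ann(I)\<close>. None of these is onto, so the \<open>j\<close>-th entry of such
  a family lies in \<open>\<mm>\<close> and kills \<open>s\<close>. Hence \<open>y \<mapsto> y\<^sub>j s\<close> factors through the image of \<open>R\<^sup>X\<close> in
  \<open>(R/Ann(I))\<^sup>T\<close>, and extends from there.\<close>

lemma no_epi_imp_socle_extension:
  assumes no_epi: "module_epi R II Rq = {}"
    and X: "finite X" "X \<subseteq> I" "I = Idl\<^bsub>R\<^esub> X"
    and T: "finite T" "T \<subseteq> {t \<in> carrier (power_module X RR). dot X (\<lambda>x\<in>X. x) t = \<zero>\<^bsub>R\<^esub>}"
    and T_gen: "\<And>V. submodule V R (power_module X RR) \<Longrightarrow> T \<subseteq> V \<Longrightarrow>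
      {t \<in> carrier (power_module X RR). dot X (\<lambda>x\<in>X. x) t = \<zero>\<^bsub>R\<^esub>} \<subseteq> V"
    and j: "j \<in> X"
  shows "\<exists>g\<in>module_hom R (power_module T Rq) E. \<forall>y\<in>carrier (power_module X RR).
    g (\<lambda>t\<in>T. cls (dot X t y)) = y j \<odot>\<^bsub>E\<^esub> s"
proof -
  let ?\<iota> = "\<lambda>x\<in>X. x" and ?P = "power_module X RR" and ?Q = "power_module T Rq"
  let ?p = "\<lambda>y. \<lambda>t\<in>T. cls (dot X t y)"
  have P: "module R ?P" by (rule module_power[OF module_RR])
  have Q: "module R ?Q" by (rule module_power[OF module_Rq])
  have PR: "u \<in> carrier ?P \<longleftrightarrow> u \<in> X \<rightarrow>\<^sub>E carrier R" for u by (simp add: power_module_simps)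
  have TP: "t \<in> X \<rightarrow>\<^sub>E carrier R" if "t \<in> T" for t using T(2) that PR by auto
  have p: "?p \<in> module_hom R ?P ?Q"
    by (rule hom_into_power) (rule module_hom_comp[OF dot_hom[OF X(1) TP] cls_hom])
  have ev: "dot X ?\<iota> \<in> module_epi R ?P II" by (rule dot_generators_epi[OF X])
  have XR: "X \<subseteq> carrier R" using X(2) I.a_subset by auto
  have \<iota>: "?\<iota> \<in> X \<rightarrow>\<^sub>E carrier R" using XR by auto
  have e: "summand_map X RR x \<one>\<^bsub>R\<^esub> \<in> carrier ?P" for x
    using summand_map_closed[OF module_RR, of "\<one>\<^bsub>R\<^esub>" X x] by (simp add: copower_module_finite[OF X(1)])
  \<comment> \<open>a family \<open>y\<close> in the kernel of \<open>?p\<close> respects all relations, hence extends to some \<open>h : I \<rightarrow> R/Ann(I)\<close>\<close>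
  have yj: "y j \<in> \<mm>" if y: "y \<in> carrier ?P" and py: "?p y = \<zero>\<^bsub>?Q\<^esub>" for y
  proof -
    have yR: "y \<in> X \<rightarrow>\<^sub>E carrier R" using y PR by simp
    note doty = dot_hom[OF X(1) yR]
    have "dot X t y \<in> \<aa>" if t: "t \<in> T" for t
    proof -
      have "cls (dot X t y) = \<zero>\<^bsub>Rq\<^esub>" using py t by (simp add: power_module_simps restrict_eq_iff)
      moreover have "dot X t y \<in> carrier R" using module_hom_closed[OF dot_hom[OF X(1) TP[OF t]] y] by simp
      ultimately show ?thesis using cls_zero by simp
    qed
    then have "T \<subseteq> {u \<in> carrier ?P. dot X y u \<in> \<aa>}"
      using T(2) dot_commute[OF TP yR] by auto
    then have K: "dot X y u \<in> \<aa>" if "u \<in> carrier ?P" "dot X ?\<iota> u = \<zero>\<^bsub>R\<^esub>" for u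
      using T_gen[OF module_hom_preimage_submodule[OF P module_RR doty \<aa>_sub]] that by auto
    have "\<exists>h\<in>module_hom R II Rq. \<forall>u\<in>carrier ?P. h (dot X ?\<iota> u) = cls (dot X y u)"
      by (rule module_hom_factor_epi[OF P module_II module_Rq ev module_hom_comp[OF doty cls_hom]])
        (use K cls_zero module_hom_closed[OF doty] in auto)
    then obtain h where h: "h \<in> module_hom R II Rq" "h (dot X ?\<iota> (summand_map X RR j \<one>\<^bsub>R\<^esub>)) =
      cls (dot X y (summand_map X RR j \<one>\<^bsub>R\<^esub>))" using e by blast
    have yjR: "y j \<in> carrier R" using yR j by auto
    have jR: "j \<in> carrier R" using j XR by auto
    have "h j = cls (y j)"
      using h(2) dot_summand[OF X(1) \<iota> j R.one_closed] dot_summand[OF X(1) yR j R.one_closed] j yjR jR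
      by simp
    then show ?thesis using no_epi_imp_hom_values[OF no_epi h(1) _ yjR] j X(2) by blast
  qed
  let ?B = "?p ` carrier ?P"
  have B: "submodule ?B R ?Q"
    by (rule module_hom_image_submodule[OF P Q p module.carrier_is_submodule[OF P]])
  have pB: "?p \<in> module_epi R ?P (?Q\<lparr>carrier := ?B\<rparr>)"
    using p by (auto simp: module_epi_def module_hom_def)
  have f: "(\<lambda>y. y j \<odot>\<^bsub>E\<^esub> s) \<in> module_hom R ?P E"
    by (rule module_hom_comp[OF power_proj_hom[OF j] ring_smult_hom[OF module_E s(1)]])
  have "\<exists>g\<in>module_hom R (?Q\<lparr>carrier := ?B\<rparr>) E. \<forall>y\<in>carrier ?P. g (?p y) = y j \<odot>\<^bsub>E\<^esub> s"
    by (rule module_hom_factor_epi[OF P submodule_module[OF Q B] module_E pB f])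
      (use yj s(3) in simp)
  then obtain g0 where g0: "g0 \<in> module_hom R (?Q\<lparr>carrier := ?B\<rparr>) E"
    "\<forall>y\<in>carrier ?P. g0 (?p y) = y j \<odot>\<^bsub>E\<^esub> s" by blast
  have "carrier ?Q \<lesssim> (UNIV :: 'm set)"
    using finite_PiE_lepoll[OF T(1) infinite_universe carrier_Rq_small] by (simp add: power_module_simps)
  then obtain g where "g \<in> module_hom R ?Q E" "\<forall>z\<in>?B. g z = g0 z"
    using injective_extension[OF inj Q _ B g0(1)] by blast
  then show ?thesis using g0(2) by (intro bexI[of _ g]) simp_all
qed

lemma factor_of_Rq_power_cogenerated:
  fixes N :: "('a, 'm) module"
  assumes closed: "closed_under_factor_modules R (cogenerated_class R I_dual :: ('a, 'm) module set)"
    and "finite X" "finite T" "module R N"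
    and F: "F \<in> module_epi R (power_module X (power_module T Rq)) N"
  shows "cogenerated_by R I_dual N"
proof -
  let ?Q = "power_module T Rq"
  let ?D = "power_module X ?Q"
  have Q: "module R ?Q" by (rule module_power[OF module_Rq])
  have D: "module R ?D" by (rule module_power[OF Q])
  have "carrier ?Q \<lesssim> (UNIV :: 'm set)"
    using finite_PiE_lepoll[OF assms(3) infinite_universe carrier_Rq_small] by (simp add: power_module_simps)
  then have "carrier ?D \<lesssim> (UNIV :: 'm set)"
    using finite_PiE_lepoll[OF assms(2) infinite_universe] unfolding power_module_simps(1)[of X] by blast
  then obtain M :: "('a, 'm) module" and \<theta> where M: "module R M" and \<theta>: "\<theta> \<in> module_iso R ?D M"
    using module_copy_exists[OF D] by blast
  have "cogenerated_by R I_dual M"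
    by (rule cogenerated_by_iso[OF module_dual D M _ \<theta>])
      (intro cogenerated_by_power module_dual module_Rq Q Rq_cogenerated)
  then have MS: "M \<in> cogenerated_class R I_dual" using M by (simp add: cogenerated_class_def)
  obtain \<rho> where \<rho>: "\<rho> \<in> module_iso R M ?D" using module_iso_inverse[OF D \<theta>] by blast
  have "(\<lambda>x. F (\<rho> x)) \<in> module_hom R M N"
    by (rule module_hom_comp[OF module_iso_hom[OF \<rho>]]) (use F in \<open>simp add: module_epi_def\<close>)
  moreover have "(\<lambda>x. F (\<rho> x)) ` carrier M = carrier N"
    using F \<rho> by (simp add: module_epi_def module_iso_def bij_betw_def image_image[symmetric])
  ultimately have "N \<in> cogenerated_class R I_dual"
    by (intro closed_under_factor_modulesD[OF closed MS M assms(4), of "\<lambda>x. F (\<rho> x)"])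
      (simp add: module_epi_def)
  then show ?thesis by (simp add: cogenerated_class_def)
qed

text \<open>The module \<open>W\<close> of the overview is \<open>N\<close>, the sum of the images of the maps
  \<open>g\<^sub>j : (R/Ann(I))\<^sup>T \<rightarrow> E\<close> for \<open>j \<in> X\<close>. All \<open>j\<close> have to be included, since the index at which
  \<open>\<beta>(s, -)\<close> does not vanish is known only after \<open>\<beta>\<close> has been chosen on \<open>N\<close>.\<close>

lemma closed_under_factor_modules_imp_epi:
  assumes closed: "closed_under_factor_modules R (cogenerated_class R I_dual :: ('a, 'm) module set)"
  shows "module_epi R II Rq \<noteq> {}"
proof
  assume no_epi: "module_epi R II Rq = {}"
  obtain X where X: "finite X" "X \<subseteq> I" "I = Idl\<^bsub>R\<^esub> X" by (rule finite_generators)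
  interpret E: module R E by (rule module_E)
  let ?\<iota> = "\<lambda>x\<in>X. x" and ?P = "power_module X RR"
  have P: "module R ?P" by (rule module_power[OF module_RR])
  have XR: "X \<subseteq> carrier R" using X(2) I.a_subset by auto
  have \<iota>: "?\<iota> \<in> X \<rightarrow>\<^sub>E carrier R" using XR by auto
  have ev: "dot X ?\<iota> ` carrier ?P = I"
    using dot_generators_epi[OF X] by (simp add: module_epi_def)
  let ?K = "{t \<in> carrier ?P. dot X ?\<iota> t = \<zero>\<^bsub>R\<^esub>}"
  have K: "submodule ?K R ?P"
    using module_hom_preimage_submodule[OF P module_RR dot_hom[OF X(1) \<iota>] zero_submodule[OF module_RR]] by simp
  obtain T where T: "T \<subseteq> ?K" "finite T" "\<forall>V. submodule V R ?P \<longrightarrow> T \<subseteq> V \<longrightarrow> ?K \<subseteq> V"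
    using finite_free_submodule_fg[OF cring noeth X(1) K] by (elim exE conjE)
  let ?Q = "power_module T Rq"
  have Q: "module R ?Q" by (rule module_power[OF module_Rq])
  let ?p = "\<lambda>y. \<lambda>t\<in>T. cls (dot X t y)"
  have "\<forall>j\<in>X. \<exists>g. g \<in> module_hom R ?Q E \<and> (\<forall>y\<in>carrier ?P. g (?p y) = y j \<odot>\<^bsub>E\<^esub> s)"
    using no_epi_imp_socle_extension[OF no_epi X T(2,1)] T(3) by blast
  from bchoice[OF this] obtain g where g: "\<And>j. j \<in> X \<Longrightarrow> g j \<in> module_hom R ?Q E"
    "\<And>j y. j \<in> X \<Longrightarrow> y \<in> carrier ?P \<Longrightarrow> g j (?p y) = y j \<odot>\<^bsub>E\<^esub> s" by blast
  let ?D = "power_module X ?Q"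
  have D: "module R ?D" by (rule module_power[OF Q])
  obtain F where F: "F \<in> module_hom R ?D E"
    "\<And>j u. j \<in> X \<Longrightarrow> u \<in> carrier ?Q \<Longrightarrow> F (summand_map X ?Q j u) = g j u"
    using hom_copower_exists[OF Q module_E, of X g] g(1) by (auto simp: copower_module_finite[OF X(1)])
  define N where "N = E\<lparr>carrier := F ` carrier ?D\<rparr>"
  have N: "module R N"
    unfolding N_def
    by (rule submodule_module[OF module_E module_hom_image_submodule[OF D module_E F(1) module.carrier_is_submodule[OF D]]])
  have FN: "F \<in> module_epi R ?D N"
    using F(1) by (auto simp: N_def module_epi_def module_hom_def)
  have N_cog: "cogenerated_by R I_dual N"
    by (rule factor_of_Rq_power_cogenerated[OF closed X(1) T(2) N FN])
  have gN: "g j \<in> module_hom R ?Q N" if j: "j \<in> X" for j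
  proof -
    have "g j u \<in> carrier N" if "u \<in> carrier ?Q" for u
      using F(2)[OF j that] summand_map_closed[OF Q that, of X j]
      by (auto simp: N_def copower_module_finite[OF X(1)] intro!: image_eqI)
    then show ?thesis using g(1)[OF j] by (auto simp: module_hom_def N_def)
  qed
  have TP: "t \<in> X \<rightarrow>\<^sub>E carrier R" if "t \<in> T" for t using T(1) that by (auto simp: power_module_simps)
  have p: "?p \<in> module_hom R ?P ?Q"
    by (rule hom_into_power) (rule module_hom_comp[OF dot_hom[OF X(1) TP] cls_hom])
  define e where "e = (\<lambda>x. summand_map X RR x \<one>\<^bsub>R\<^esub>)"
  have e: "e x \<in> carrier ?P" for x
    using summand_map_closed[OF module_RR, of "\<one>\<^bsub>R\<^esub>" X x] by (simp add: e_def copower_module_finite[OF X(1)])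
  \<comment> \<open>the system of linear equations that the elements \<open>w t\<close> below solve\<close>
  have ge: "g j (?p (e x)) = (if x = j then s else \<zero>\<^bsub>E\<^esub>)" if "j \<in> X" for j x
    using g(2)[OF that e[of x]] that s(1) by (simp add: e_def summand_map_def)
  have pe: "?p (e x) = (\<lambda>t\<in>T. cls (t x))" if x: "x \<in> X" for x
  proof (rule restrict_ext)
    fix t assume t: "t \<in> T"
    have "t x \<in> carrier R" using TP[OF t] x by auto
    then show "cls (dot X t (e x)) = cls (t x)"
      using dot_summand[OF X(1) TP[OF t] x R.one_closed] by (simp add: e_def)
  qed
  have "X \<noteq> {}"
  proof
    assume "X = {}"
    then have "I \<subseteq> {\<zero>\<^bsub>R\<^esub>}" using ev by (auto simp: dot_def)
    then have "\<one>\<^bsub>R\<^esub> \<in> \<aa>" by (auto simp: annihilator_iff)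
    then show False using no_epi_imp_annihilator_le[OF no_epi] one_notin_\<mm> by blast
  qed
  then obtain j0 where j0: "j0 \<in> X" by blast
  have sN: "s \<in> carrier N"
    using module_hom_closed[OF gN[OF j0] module_hom_closed[OF p e[of j0]]] ge[OF j0, of j0] by simp
  have zN: "\<zero>\<^bsub>N\<^esub> = \<zero>\<^bsub>E\<^esub>" by (simp add: N_def)
  obtain \<beta> i where \<beta>: "\<And>i. i \<in> I \<Longrightarrow> (\<lambda>x. \<beta> x i) \<in> module_hom R N E"
    "\<And>x. x \<in> carrier N \<Longrightarrow> \<beta> x \<in> module_hom R II E" and i: "i \<in> I" "\<beta> s i \<noteq> \<zero>\<^bsub>E\<^esub>"
    using N_cog sN s(2) zN unfolding cogenerated_iff[OF N] by metis
  have "\<exists>j\<in>X. \<beta> s j \<noteq> \<zero>\<^bsub>E\<^esub>"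
  proof (rule ccontr)
    assume "\<not> (\<exists>j\<in>X. \<beta> s j \<noteq> \<zero>\<^bsub>E\<^esub>)"
    then have z: "\<beta> s x = \<zero>\<^bsub>E\<^esub>" if "x \<in> X" for x using that by blast
    obtain u where u: "u \<in> carrier ?P" "i = dot X ?\<iota> u" using ev i(1) by blast
    have "\<beta> s i = (\<Oplus>\<^bsub>E\<^esub>x\<in>X. u x \<odot>\<^bsub>E\<^esub> \<beta> s x)"
      unfolding u(2) by (rule hom_dot_generators[OF X module_E \<beta>(2)[OF sN] u(1)])
    also have "\<dots> = (\<Oplus>\<^bsub>E\<^esub>x\<in>X. \<zero>\<^bsub>E\<^esub>)"
    proof (rule E.M.finsum_cong'[OF refl])
      fix x assume x: "x \<in> X"
      then have "u x \<in> carrier R" using u(1) by (auto simp: power_module_simps)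
      then show "u x \<odot>\<^bsub>E\<^esub> \<beta> s x = \<zero>\<^bsub>E\<^esub>" using z[OF x] by simp
    qed auto
    finally show False using i(2) by simp
  qed
  then obtain j where j: "j \<in> X" "\<beta> s j \<noteq> \<zero>\<^bsub>E\<^esub>" by blast
  define w where "w = (\<lambda>t. g j (summand_map T Rq t (cls \<one>\<^bsub>R\<^esub>)))"
  have c1: "cls r \<in> carrier Rq" if "r \<in> carrier R" for r using that by (simp add: carrier_Rq)
  have sumT: "summand_map T Rq t c \<in> carrier ?Q" if "c \<in> carrier Rq" for t c
    using summand_map_closed[OF module_Rq that, of T t] by (simp add: copower_module_finite[OF T(2)])
  have wN: "w t \<in> carrier N" for t
    unfolding w_def by (rule module_hom_closed[OF gN[OF j(1)] sumT[OF c1[OF R.one_closed]]])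
  have tR: "t x \<in> carrier R" if "t \<in> T" "x \<in> X" for t x using TP[OF that(1)] that(2) by auto
  have b: "\<beta> (w t) x \<in> carrier E" if "x \<in> X" for t x
    using module_hom_closed[OF \<beta>(2)[OF wN[of t]], of x] X(2) that by auto
  have expand: "\<beta> (g j (?p (e x))) x = (\<Oplus>\<^bsub>E\<^esub>t\<in>T. t x \<odot>\<^bsub>E\<^esub> \<beta> (w t) x)" if x: "x \<in> X" for x
  proof -
    have xI: "x \<in> I" using x X(2) by auto
    let ?\<gamma> = "\<lambda>u. \<beta> (g j u) x"
    have \<gamma>: "?\<gamma> \<in> module_hom R ?Q E" by (rule module_hom_comp[OF gN[OF j(1)] \<beta>(1)[OF xI]])
    have pe_mem: "?p (e x) \<in> carrier (copower_module T Rq)"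
      using module_hom_closed[OF p e[of x]] unfolding copower_module_finite[OF T(2)] .
    have "?\<gamma> (?p (e x)) = (\<Oplus>\<^bsub>E\<^esub>t\<in>T. ?\<gamma> (summand_map T Rq t (?p (e x) t)))"
      by (rule hom_copower_expand[OF module_Rq module_E _ T(2) subset_refl pe_mem])
        (use \<gamma> in \<open>simp_all add: copower_module_finite[OF T(2)]\<close>)
    also have "\<dots> = (\<Oplus>\<^bsub>E\<^esub>t\<in>T. t x \<odot>\<^bsub>E\<^esub> \<beta> (w t) x)"
    proof (rule E.M.finsum_cong'[OF refl])
      show "(\<lambda>t. t x \<odot>\<^bsub>E\<^esub> \<beta> (w t) x) \<in> T \<rightarrow> carrier E" using b tR x by auto
      fix t assume t: "t \<in> T"
      have "?p (e x) t = t x \<odot>\<^bsub>Rq\<^esub> cls \<one>\<^bsub>R\<^esub>"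
        using pe[OF x] t tR[OF t x] by (simp add: cls_smult)
      then have "summand_map T Rq t (?p (e x) t) = t x \<odot>\<^bsub>?Q\<^esub> summand_map T Rq t (cls \<one>\<^bsub>R\<^esub>)"
        using module_hom_smult[OF summand_map_hom[OF module_Rq, of T t] tR[OF t x] c1[OF R.one_closed]]
        by (simp add: copower_module_finite[OF T(2)])
      then show "?\<gamma> (summand_map T Rq t (?p (e x) t)) = t x \<odot>\<^bsub>E\<^esub> \<beta> (w t) x"
        using module_hom_smult[OF \<gamma> tR[OF t x] sumT[OF c1[OF R.one_closed]]] by (simp add: w_def)
    qed
    finally show ?thesis .
  qed
  have "\<beta> s j = (\<Oplus>\<^bsub>E\<^esub>x\<in>X. if j = x then \<beta> s x else \<zero>\<^bsub>E\<^esub>)"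
    by (rule E.M.add.finprod_singleton[OF j(1) X(1), symmetric])
      (use module_hom_closed[OF \<beta>(2)[OF sN]] X(2) in auto)
  also have "\<dots> = (\<Oplus>\<^bsub>E\<^esub>x\<in>X. \<beta> (g j (?p (e x))) x)"
  proof (rule E.M.finsum_cong'[OF refl])
    fix x assume x: "x \<in> X"
    then have "x \<in> I" using X(2) by auto
    then have "\<beta> \<zero>\<^bsub>E\<^esub> x = \<zero>\<^bsub>E\<^esub>" using module_hom_zero[OF N module_E \<beta>(1)] zN by simp
    then show "(if j = x then \<beta> s x else \<zero>\<^bsub>E\<^esub>) = \<beta> (g j (?p (e x))) x"
      unfolding ge[OF j(1)] by auto
  next
    show "(\<lambda>x. \<beta> (g j (?p (e x))) x) \<in> X \<rightarrow> carrier E"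
      using expand b tR by (auto intro!: E.M.finsum_closed)
  qed
  also have "\<dots> = (\<Oplus>\<^bsub>E\<^esub>x\<in>X. \<Oplus>\<^bsub>E\<^esub>t\<in>T. t x \<odot>\<^bsub>E\<^esub> \<beta> (w t) x)"
    by (rule E.M.finsum_cong'[OF refl _ expand]) (use b tR in \<open>auto intro!: E.M.finsum_closed\<close>)
  also have "\<dots> = (\<Oplus>\<^bsub>E\<^esub>t\<in>T. \<Oplus>\<^bsub>E\<^esub>x\<in>X. t x \<odot>\<^bsub>E\<^esub> \<beta> (w t) x)"
    by (rule E.M.finsum_swap[OF X(1) T(2)]) (use b tR in auto)
  also have "\<dots> = (\<Oplus>\<^bsub>E\<^esub>t\<in>T. \<zero>\<^bsub>E\<^esub>)"
  proof (rule E.M.finsum_cong'[OF refl])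
    fix t assume t: "t \<in> T"
    have "(\<Oplus>\<^bsub>E\<^esub>x\<in>X. t x \<odot>\<^bsub>E\<^esub> \<beta> (w t) x) = \<beta> (w t) (dot X ?\<iota> t)"
      by (rule hom_dot_generators[OF X module_E \<beta>(2)[OF wN], symmetric]) (use t T(1) in auto)
    also have "dot X ?\<iota> t = \<zero>\<^bsub>II\<^esub>" using t T(1) by auto
    also have "\<beta> (w t) \<zero>\<^bsub>II\<^esub> = \<zero>\<^bsub>E\<^esub>" by (rule module_hom_zero[OF module_II module_E \<beta>(2)[OF wN]])
    finally show "(\<Oplus>\<^bsub>E\<^esub>x\<in>X. t x \<odot>\<^bsub>E\<^esub> \<beta> (w t) x) = \<zero>\<^bsub>E\<^esub>" .
  qed auto
  finally show False using j(2) by simp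
qed

end

section \<open>The equivalences\<close>

theorem mainTheorem8:
  fixes R :: "('a, 'b) ring_scheme" and \<mm> I :: "'a set" and E :: "('a, 'm) module"
  assumes "local_ring R \<mm>" and "noetherian_ring R"
    and "ideal I R"
    and "injective_hull R (quotient_module (ring_module R) \<mm>) E"
    and "infinite (UNIV :: 'm set)" and "carrier R \<lesssim> (UNIV :: 'm set)"
  shows
    "let \<P> = (generated_class R (ideal_module R I) :: ('a, 'm) module set);
         \<S> = (cogenerated_class R (hom_module R (ideal_module R I) E) :: ('a, 'm) module set);
         Ann = annihilator R (ideal_module R I);
         i = closed_under_submodules R \<P>;
         ii = closed_under_factor_modules R \<S>;
         iii = (\<P> = \<S> \<and> \<S> = annihilated_class R Ann);
         iv = (module_epi R (ideal_module R I) (quotient_module (ring_module R) Ann) \<noteq> {})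
     in (i \<longleftrightarrow> ii) \<and> (ii \<longleftrightarrow> iii) \<and> (iii \<longleftrightarrow> iv)"
proof -
  obtain s where s: "s \<in> carrier E" "s \<noteq> \<zero>\<^bsub>E\<^esub>" "\<And>r. r \<in> \<mm> \<Longrightarrow> r \<odot>\<^bsub>E\<^esub> s = \<zero>\<^bsub>E\<^esub>"
    using injective_hull_residue_field[OF assms(1,4)] by blast
  interpret L: local_ring_ideal_cogenerator R \<mm> I E s
    by (rule local_ring_ideal_cogenerator.intro) (use assms s in \<open>simp_all add: injective_hull_def\<close>)
  let ?P = "generated_class R (ideal_module R I) :: ('a, 'm) module set"
  let ?S = "cogenerated_class R (hom_module R (ideal_module R I) E) :: ('a, 'm) module set"
  let ?A = "annihilated_class R (annihilator R (ideal_module R I)) :: ('a, 'm) module set"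
  let ?epi = "module_epi R (ideal_module R I)
    (quotient_module (ring_module R) (annihilator R (ideal_module R I)))"
  have PA: "?P \<subseteq> ?A"
    using L.generated_annihilated by (auto simp: generated_class_def annihilated_class_def)
  have SA: "?S \<subseteq> ?A"
    using L.cogenerated_annihilated by (auto simp: cogenerated_class_def annihilated_class_def)
  have iv_iii: "?P = ?A \<and> ?S = ?A" if ne: "?epi \<noteq> {}"
  proof -
    obtain \<pi> where \<pi>: "\<pi> \<in> ?epi" using ne by blast
    have "?A \<subseteq> ?P"
      using L.epi_imp_generated[OF \<pi>] by (auto simp: generated_class_def annihilated_class_def)
    moreover have "?A \<subseteq> ?S"
      using L.epi_imp_cogenerated[OF \<pi>] by (auto simp: cogenerated_class_def annihilated_class_def)
    ultimately show ?thesis using PA SA by blast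
  qed
  have "closed_under_submodules R ?P \<longleftrightarrow> ?epi \<noteq> {}"
    using L.closed_under_submodules_imp_epi iv_iii L.annihilated_closed_under_submodules by metis
  moreover have "closed_under_factor_modules R ?S \<longleftrightarrow> ?epi \<noteq> {}"
    using L.closed_under_factor_modules_imp_epi iv_iii L.annihilated_closed_under_factor_modules by metis
  moreover have "(?P = ?S \<and> ?S = ?A) \<longleftrightarrow> ?epi \<noteq> {}"
    using iv_iii L.closed_under_submodules_imp_epi L.annihilated_closed_under_submodules by metis
  ultimately show ?thesis unfolding Let_def by blast
qed

end
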